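(* Let $\ell\ge 1$ and let $k_1\ge\cdots\ge k_\ell\ge 2$ be integers. Let $F_\ell=\bigcup_{i=1}^{\ell}P_{k_i}$ be the corresponding linear forest, put $p=\sum_{i=1}^{\ell}\lfloor k_i/2\rfloor-1$ and assume $p\ge 1$. Let $\alpha\in(0,1)$. Then there exists $n_0$ (depending on $k_1,\dots,k_\ell$ and $\alpha$) such that for every $n\ge n_0$ and every $F_\ell$-free graph $G$ of order $n$ the following holds, where $$f(x)=x^3-(p+n\alpha+p\alpha)x^2+(p-np+n\alpha-2p\alpha+p^2+np\alpha^2+2np\alpha-1)x+p^2\alpha^2-2p+p^3\alpha^2+np+5p\alpha-2p\alpha^2+p^2\alpha-p^3\alpha-p^2+np^2\alpha-2np^2\alpha^2-2np\alpha .$$ (i) If at least one $k_i$ is even, then $$\rho_\alpha(G)\le\frac{\alpha n+p-1+\sqrt{(\alpha n+p-1)^2-4p(2\alpha-1)n-4p(p-(p+1)\alpha)}}{2},$$ with equality if and only if $G=S_{n,p}$. (ii) If all $k_i$ are odd and at least one $k_i>3$, then $\rho_\alpha(G)$ is at most the largest root of $f(x)=0$, with equality if and only if $G=S^+_{n,p}$. (iii) If $k_1=\cdots=k_\ell=3$, then $\rho_\alpha(G)\le t_\alpha(n,p)$, with equality if and only if $G=F_{n,p}$, where $$t_\alpha(n,p)=\frac{p+\alpha n+\sqrt{(\alpha n-3p)^2+4(p-\alpha)n+4(p+2)(\alpha p-3p+5)-36}}{2}$$ if $n-p$ is even, and $t_\alpha(n,p)$ is the largest root of $f(x)-p(\alpha-1)^2(n-p-3)=0$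 if $n-p$ is odd.
   Context: All graphs are finite, simple and undirected; equality of graphs means isomorphism. For a graph $G$, $A(G)$ is its adjacency matrix, $D(G)$ its diagonal degree matrix, $A_\alpha(G)=\alpha D(G)+(1-\alpha)A(G)$ for $\alpha\in[0,1]$, and $\rho_\alpha(G)$ denotes the largest eigenvalue of $A_\alpha(G)$. $P_k$ is the path on $k$ vertices; a linear forest is a vertex-disjoint union of paths. A graph is $H$-free if it contains no (not necessarily induced) subgraph isomorphic to $H$. $G\cup H$ is the disjoint union, $kG$ the disjoint union of $k$ copies of $G$, $\overline{G}$ the complement, and $G\nabla H$ the join (disjoint union plus all edges between $G$ and $H$). Define $S_{n,p}=K_p\nabla\overline{K}_{n-p}$, $S^+_{n,p}=K_p\nabla(\overline{K}_{n-p-2}\cup K_2)$, and $F_{n,p}=K_p\nabla(tK_2\cup rK_1)$, where $n-p=2t+r$ with $0\le r<2$. *)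

theory Defs
  imports
    "Graph_Theory.Graph_Theory"
    "Jordan_Normal_Form.Spectral_Radius"
begin

text \<open>A finite simple undirected graph is a symmetric, loop-free, finite pair digraph, i.e. it
  satisfies \<open>pair_graph\<close>: every undirected edge is represented by its two arcs. Graphs are equal
  in the sense of the theorem if they are related by \<open>digraph_iso\<close>.\<close>

definition complete_graph :: "nat \<Rightarrow> nat pair_pre_digraph" where
  "complete_graph n = \<lparr> pverts = {..<n}, parcs = {(i, j). i < n \<and> j < n \<and> i \<noteq> j} \<rparr>"

definition path_graph :: "nat \<Rightarrow> nat pair_pre_digraph" where
  "path_graph n = \<lparr> pverts = {..<n}, parcs = {(i, j). i < n \<and> j < n \<and> (j = Suc i \<or> i = Suc j)} \<rparr>"

definition graph_complement :: "'a pair_pre_digraph \<Rightarrow> 'a pair_pre_digraph" where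
  "graph_complement G =
    \<lparr> pverts = pverts G,
      parcs = {(u, v). u \<in> pverts G \<and> v \<in> pverts G \<and> u \<noteq> v \<and> (u, v) \<notin> parcs G} \<rparr>"

text \<open>Disjointness of the vertex sets is enforced by tagging: with a sum type for two graphs, with
  the index for a family of graphs.\<close>

definition disjoint_union ::
  "'a pair_pre_digraph \<Rightarrow> 'b pair_pre_digraph \<Rightarrow> ('a + 'b) pair_pre_digraph" where
  "disjoint_union G H =
    \<lparr> pverts = pverts G <+> pverts H,
      parcs = {(Inl u, Inl v) | u v. (u, v) \<in> parcs G} \<union> {(Inr u, Inr v) | u v. (u, v) \<in> parcs H} \<rparr>"

definition graph_join ::
  "'a pair_pre_digraph \<Rightarrow> 'b pair_pre_digraph \<Rightarrow> ('a + 'b) pair_pre_digraph" where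
  "graph_join G H =
    \<lparr> pverts = pverts (disjoint_union G H),
      parcs = parcs (disjoint_union G H)
        \<union> {(Inl u, Inr v) | u v. u \<in> pverts G \<and> v \<in> pverts H}
        \<union> {(Inr v, Inl u) | u v. u \<in> pverts G \<and> v \<in> pverts H} \<rparr>"

definition disjoint_Union ::
  "'i set \<Rightarrow> ('i \<Rightarrow> 'a pair_pre_digraph) \<Rightarrow> ('i \<times> 'a) pair_pre_digraph" where
  "disjoint_Union I H =
    \<lparr> pverts = (SIGMA i:I. pverts (H i)),
      parcs = {((i, u), (i, v)) | i u v. i \<in> I \<and> (u, v) \<in> parcs (H i)} \<rparr>"

definition graph_copies :: "nat \<Rightarrow> 'a pair_pre_digraph \<Rightarrow> (nat \<times> 'a) pair_pre_digraph" where
  "graph_copies m G = disjoint_Union {..<m} (\<lambda>_. G)"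

definition linear_forest :: "nat \<Rightarrow> (nat \<Rightarrow> nat) \<Rightarrow> (nat \<times> nat) pair_pre_digraph" where
  "linear_forest l k = disjoint_Union {1..l} (\<lambda>i. path_graph (k i))"

definition graph_free :: "'a pair_pre_digraph \<Rightarrow> 'b pair_pre_digraph \<Rightarrow> bool" where
  "graph_free F G \<longleftrightarrow> \<not> (\<exists>H. subgraph H (with_proj G) \<and> digraph_iso H (with_proj F))"

text \<open>The three extremal graphs are meant for \<open>n \<ge> p\<close>, \<open>n \<ge> p + 2\<close> and \<open>n \<ge> p\<close>, respectively;
  below these bounds the subtraction on natural numbers truncates.\<close>

definition S_graph :: "nat \<Rightarrow> nat \<Rightarrow> (nat + nat) pair_pre_digraph" where
  "S_graph n p = graph_join (complete_graph p) (graph_complement (complete_graph (n - p)))"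

definition S_plus_graph :: "nat \<Rightarrow> nat \<Rightarrow> (nat + (nat + nat)) pair_pre_digraph" where
  "S_plus_graph n p =
    graph_join (complete_graph p)
      (disjoint_union (graph_complement (complete_graph (n - p - 2))) (complete_graph 2))"

definition F_graph :: "nat \<Rightarrow> nat \<Rightarrow> (nat + ((nat \<times> nat) + (nat \<times> nat))) pair_pre_digraph" where
  "F_graph n p =
    (let t = (n - p) div 2; r = (n - p) mod 2
     in graph_join (complete_graph p)
          (disjoint_union (graph_copies t (complete_graph 2)) (graph_copies r (complete_graph 1))))"

text \<open>Rows and columns of the matrices are indexed by the vertices in increasing order.\<close>

definition vertex_list :: "nat pair_pre_digraph \<Rightarrow> nat list" where
  "vertex_list G = sorted_list_of_set (pverts G)"

definition adjacency_matrix :: "nat pair_pre_digraph \<Rightarrow> real mat" where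
  "adjacency_matrix G =
    mat (card (pverts G)) (card (pverts G))
      (\<lambda>(i, j). if (vertex_list G ! i, vertex_list G ! j) \<in> parcs G then 1 else 0)"

text \<open>Since both arcs of an edge are present, the degree of a vertex is its out-degree.\<close>

definition degree_matrix :: "nat pair_pre_digraph \<Rightarrow> real mat" where
  "degree_matrix G =
    mat (card (pverts G)) (card (pverts G))
      (\<lambda>(i, j). if i = j then real (out_degree (with_proj G) (vertex_list G ! i)) else 0)"

definition A_alpha :: "real \<Rightarrow> nat pair_pre_digraph \<Rightarrow> real mat" where
  "A_alpha \<alpha> G = \<alpha> \<cdot>\<^sub>m degree_matrix G + (1 - \<alpha>) \<cdot>\<^sub>m adjacency_matrix G"

text \<open>The matrix is real symmetric, so its real eigenvalues are all its eigenvalues; for a graph with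
  at least one vertex the spectrum is finite and nonempty.\<close>

definition rho_alpha :: "real \<Rightarrow> nat pair_pre_digraph \<Rightarrow> real" where
  "rho_alpha \<alpha> G = Max (spectrum (A_alpha \<alpha> G))"

definition f_cubic :: "real \<Rightarrow> real \<Rightarrow> real \<Rightarrow> real \<Rightarrow> real" where
  "f_cubic \<alpha> n p x =
    x ^ 3 - (p + n * \<alpha> + p * \<alpha>) * x ^ 2
    + (p - n * p + n * \<alpha> - 2 * p * \<alpha> + p ^ 2 + n * p * \<alpha> ^ 2 + 2 * n * p * \<alpha> - 1) * x
    + p ^ 2 * \<alpha> ^ 2 - 2 * p + p ^ 3 * \<alpha> ^ 2 + n * p + 5 * p * \<alpha> - 2 * p * \<alpha> ^ 2 + p ^ 2 * \<alpha>
    - p ^ 3 * \<alpha> - p ^ 2 + n * p ^ 2 * \<alpha> - 2 * n * p ^ 2 * \<alpha> ^ 2 - 2 * n * p * \<alpha>"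

text \<open>Only used for monic real cubics, which have a finite nonempty set of real roots.\<close>

definition largest_root :: "(real \<Rightarrow> real) \<Rightarrow> real" where
  "largest_root g = Max {x. g x = 0}"

definition t_alpha :: "real \<Rightarrow> nat \<Rightarrow> nat \<Rightarrow> real" where
  "t_alpha \<alpha> n p =
    (if even (n - p)
     then (real p + \<alpha> * real n
           + sqrt ((\<alpha> * real n - 3 * real p) ^ 2 + 4 * (real p - \<alpha>) * real n
                   + 4 * (real p + 2) * (\<alpha> * real p - 3 * real p + 5) - 36)) / 2
     else largest_root (\<lambda>x. f_cubic \<alpha> (real n) (real p) x
                            - real p * (\<alpha> - 1) ^ 2 * (real n - real p - 3)))"

end

theory Submission
  imports Defs "HOL-Analysis.Function_Topology" "HOL-Real_Asymp.Real_Asymp"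
begin

text \<open>Let \<open>V\<close> and \<open>E\<close> be the vertices and arcs of a graph of order \<open>n\<close> that contains no copy of the linear
  forest, and let \<open>N\<close> be the number of vertices of the forest. Since \<open>\<alpha> > 0\<close>, the diagonal part of
  \<open>A\<^sub>\<alpha>\<close> dominates, and the proof is a comparison of quadratic forms.

  The largest eigenvalue \<open>\<rho>\<close> is the maximum of the Rayleigh quotient of \<open>A\<^sub>\<alpha>\<close>, and it has a nonnegative
  eigenvector \<open>x\<close>, normalised to have maximum \<open>1\<close>. A graph without the forest has degree
  sum at most \<open>2Nn\<close> (a subgraph of minimum degree \<open>N\<close> contains the forest greedily), so
  \<open>\<rho> \<Sum> x\<^sub>v = \<Sum> d\<^sub>v x\<^sub>v\<close> bounds \<open>\<Sum> x\<^sub>v\<close> by a constant. Suppose that \<open>\<rho>\<close> is at least the radius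
  of the complete split graph \<open>S\<^bsub>n,p\<^esub>\<close>, which is \<open>\<alpha>n - 1 + p(1 - \<alpha>)/\<alpha> + o(1)\<close>. Let \<open>M\<close> be the set
  of vertices of degree at least \<open>n - K\<close> for a large constant \<open>K\<close>. Outside \<open>M\<close> the entries of \<open>x\<close> are
  small, and a short computation gives \<open>\<Sum>\<^bsub>M\<^esub> x\<^sub>v > p - 1/2\<close> (\<open>weight_of_large_degrees\<close>). On the
  other hand, \<open>p + 1\<close> vertices with many common neighbours already carry the forest, as a path on \<open>k\<close>
  vertices has a bipartition class of size \<open>\<lfloor>k/2\<rfloor>\<close>. Hence \<open>M\<close> has exactly \<open>p\<close> vertices, all of weight
  at least \<open>1/2\<close>, while outside \<open>M\<close> the degrees are bounded and the entries are \<open>O(1/n)\<close>. If some vertex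
  of \<open>M\<close> misses another vertex, then passing to the complete split graph on \<open>M\<close> raises the quadratic
  form by at least \<open>\<alpha>/4\<close> and lowers it by only \<open>O(1/n)\<close> (\<open>radius_less_split\<close>), which contradicts the
  choice of \<open>\<rho>\<close>. So every vertex of \<open>M\<close> is joined to all other vertices (\<open>eventually_dominating\<close>).

  Once \<open>M\<close> is completely joined, an arc outside \<open>M\<close> saves one centre on a path of even order, a path
  with three vertices outside \<open>M\<close> saves one on a path of odd order, and two disjoint edges outside \<open>M\<close>
  save one on a path of odd order at least five. In the three cases the edges outside \<open>M\<close> therefore
  form a matching that covers no vertex, at most two vertices, or at most \<open>2\<lfloor>(n - p)/2\<rfloor>\<close> vertices.
  If it covers \<open>m\<close> vertices, then the eigenvector is constant on three classes of vertices, and \<open>\<rho>\<close> is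
  the only root greater than \<open>\<alpha>p + 1\<close> of an explicit cubic (\<open>radius_of_matched_join\<close>). This root
  increases strictly with \<open>m\<close> (\<open>join_poly_root_mono\<close>, \<open>join_poly_root_inj\<close>),
  so the largest possible \<open>m\<close> is forced, and \<open>n\<close>, \<open>p\<close> and \<open>m\<close> determine such a graph up to isomorphism
  (\<open>iso_of_matched_joins\<close>).\<close>

section \<open>The quadratic form and its maximum\<close>

text \<open>A finite simple graph on the vertex set \<open>V\<close>; each edge is represented by its two arcs in \<open>E\<close>.\<close>
locale fin_graph =
  fixes V :: "'a set" and E :: "'a rel"
  assumes finite_V: "finite V"
    and E_sub: "E \<subseteq> V \<times> V"
    and E_sym: "(u, v) \<in> E \<Longrightarrow> (v, u) \<in> E"
    and E_irrefl: "(v, v) \<notin> E"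

text \<open>The degree of a vertex, as its number of out-neighbours.\<close>
definition deg :: "'a rel \<Rightarrow> 'a \<Rightarrow> nat" where
  "deg E v = card (E `` {v})"

text \<open>The linear map of \<open>A\<^sub>\<alpha>\<close>, acting on functions on the vertices.\<close>
definition alpha_op :: "real \<Rightarrow> 'a rel \<Rightarrow> ('a \<Rightarrow> real) \<Rightarrow> 'a \<Rightarrow> real" where
  "alpha_op \<alpha> E x v = \<alpha> * real (deg E v) * x v + (1 - \<alpha>) * (\<Sum>w\<in>E `` {v}. x w)"

text \<open>The quadratic form \<open>x \<mapsto> x\<^sup>T A\<^sub>\<alpha> x\<close>, written as a sum over the arcs. For \<open>0 \<le> \<alpha> \<le> 1\<close> and
  nonnegative \<open>x\<close> every summand is nonnegative, so adding arcs does not decrease the form.\<close>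
definition alpha_form :: "real \<Rightarrow> 'a rel \<Rightarrow> ('a \<Rightarrow> real) \<Rightarrow> real" where
  "alpha_form \<alpha> E x = (\<Sum>(v, w)\<in>E. \<alpha> * (x v)\<^sup>2 + (1 - \<alpha>) * (x v * x w))"

text \<open>\<open>r\<close> bounds the Rayleigh quotient of \<open>A\<^sub>\<alpha>\<close> and is attained at a nonnegative eigenvector. Such an
  \<open>r\<close> is unique, and it is the largest eigenvalue.\<close>
definition is_alpha_radius :: "real \<Rightarrow> 'a set \<Rightarrow> 'a rel \<Rightarrow> real \<Rightarrow> bool" where
  "is_alpha_radius \<alpha> V E r \<longleftrightarrow>
     (\<forall>y. alpha_form \<alpha> E y \<le> r * (\<Sum>v\<in>V. (y v)\<^sup>2)) \<and>
     (\<exists>x. (\<forall>v. 0 \<le> x v) \<and> (\<exists>v\<in>V. x v \<noteq> 0) \<and> (\<forall>v\<in>V. alpha_op \<alpha> E x v = r * x v))"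

context fin_graph
begin

lemma finite_E: "finite E"
  using finite_V E_sub by (meson finite_SigmaI finite_subset)

lemma nbhd_sub: "E `` {v} \<subseteq> V"
  using E_sub by auto

lemma finite_nbhd: "finite (E `` {v})"
  using nbhd_sub finite_V by (rule finite_subset)

lemma sum_over_arcs: "(\<Sum>v\<in>V. \<Sum>w\<in>E `` {v}. g v w) = (\<Sum>(v, w)\<in>E. g v w)"
proof -
  have "E = (SIGMA v:V. E `` {v})" using E_sub by auto
  then show ?thesis
    using sum.Sigma[of V "\<lambda>v. E `` {v}" g] finite_V finite_nbhd by simp
qed

lemma sum_arcs_swap: "(\<Sum>(v, w)\<in>E. g v w) = (\<Sum>(v, w)\<in>E. g w v)"
  by (rule sum.reindex_bij_witness[of _ "\<lambda>(v, w). (w, v)" "\<lambda>(v, w). (w, v)"]) (auto intro: E_sym)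

lemma sum_op: "(\<Sum>v\<in>V. y v * alpha_op \<alpha> E x v)
    = (\<Sum>(v, w)\<in>E. \<alpha> * (x v * y v) + (1 - \<alpha>) * (y v * x w))"
proof -
  have "y v * alpha_op \<alpha> E x v = (\<Sum>w\<in>E `` {v}. \<alpha> * (x v * y v) + (1 - \<alpha>) * (y v * x w))" for v
    by (simp add: alpha_op_def deg_def sum.distrib sum_distrib_left distrib_left mult_ac)
  then show ?thesis by (simp only: sum_over_arcs)
qed

lemma form_eq: "alpha_form \<alpha> E x = (\<Sum>v\<in>V. x v * alpha_op \<alpha> E x v)"
  unfolding sum_op alpha_form_def by (simp add: power2_eq_square)

lemma op_sym: "(\<Sum>v\<in>V. y v * alpha_op \<alpha> E x v) = (\<Sum>v\<in>V. x v * alpha_op \<alpha> E y v)"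
proof -
  have "(\<Sum>(v, w)\<in>E. y v * x w) = (\<Sum>(v, w)\<in>E. x v * y w)"
    by (subst sum_arcs_swap) (simp add: mult.commute)
  then show ?thesis
    unfolding sum_op by (simp add: case_prod_beta sum.distrib mult.commute flip: sum_distrib_left)
qed

lemma op_add: "alpha_op \<alpha> E (\<lambda>v. x v + t * y v) v = alpha_op \<alpha> E x v + t * alpha_op \<alpha> E y v"
  by (simp add: alpha_op_def sum.distrib sum_distrib_left algebra_simps)

lemma form_add:
  "alpha_form \<alpha> E (\<lambda>v. x v + t * y v)
    = alpha_form \<alpha> E x + 2 * t * (\<Sum>v\<in>V. y v * alpha_op \<alpha> E x v) + t\<^sup>2 * alpha_form \<alpha> E y"
proof -
  have "alpha_form \<alpha> E (\<lambda>v. x v + t * y v)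
     = alpha_form \<alpha> E x + t * (\<Sum>v\<in>V. x v * alpha_op \<alpha> E y v)
       + t * (\<Sum>v\<in>V. y v * alpha_op \<alpha> E x v) + t\<^sup>2 * alpha_form \<alpha> E y"
    unfolding form_eq op_add
    by (simp add: sum.distrib sum_distrib_left algebra_simps power2_eq_square)
  then show ?thesis by (simp add: op_sym[of x \<alpha> y])
qed

lemma form_scale: "alpha_form \<alpha> E (\<lambda>v. c * x v) = c\<^sup>2 * alpha_form \<alpha> E x"
  unfolding alpha_form_def
  by (simp add: sum_distrib_left case_prod_beta algebra_simps power2_eq_square)

lemma form_cong: "(\<And>v. v \<in> V \<Longrightarrow> x v = y v) \<Longrightarrow> alpha_form \<alpha> E x = alpha_form \<alpha> E y"
  unfolding alpha_form_def using E_sub by (intro sum.cong) auto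

lemma form_le_abs:
  assumes "\<alpha> \<le> 1" shows "alpha_form \<alpha> E x \<le> alpha_form \<alpha> E (\<lambda>v. \<bar>x v\<bar>)"
  unfolding alpha_form_def
proof (intro sum_mono, clarify)
  fix v w
  have "x v * x w \<le> \<bar>x v\<bar> * \<bar>x w\<bar>" by (metis abs_ge_self abs_mult)
  then show "\<alpha> * (x v)\<^sup>2 + (1 - \<alpha>) * (x v * x w) \<le> \<alpha> * \<bar>x v\<bar>\<^sup>2 + (1 - \<alpha>) * (\<bar>x v\<bar> * \<bar>x w\<bar>)"
    using assms by (auto intro!: mult_left_mono)
qed

lemma radius_bound_eigenvalue:
  assumes "is_alpha_radius \<alpha> V E r" "\<And>v. v \<in> V \<Longrightarrow> alpha_op \<alpha> E x v = s * x v" "v \<in> V" "x v \<noteq> 0"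
  shows "s \<le> r"
proof -
  have "alpha_form \<alpha> E x = s * (\<Sum>v\<in>V. (x v)\<^sup>2)"
    unfolding form_eq using assms(2) by (simp add: sum_distrib_left power2_eq_square algebra_simps)
  then have "s * (\<Sum>v\<in>V. (x v)\<^sup>2) \<le> r * (\<Sum>v\<in>V. (x v)\<^sup>2)"
    using assms(1) unfolding is_alpha_radius_def by metis
  moreover have "(\<Sum>v\<in>V. (x v)\<^sup>2) > 0"
    using assms(3,4) finite_V by (intro sum_pos2[of _ v]) auto
  ultimately show ?thesis by simp
qed

text \<open>The Rayleigh quotient is maximised over the nonnegative unit vectors, which form a compact set.
  Since replacing \<open>y\<close> by \<open>\<bar>y\<bar>\<close> does not decrease the form, the maximum \<open>r\<close> bounds the quotient on all
  vectors; so \<open>r \<Sum> y\<^sub>v\<^sup>2\<close> minus the form is nonnegative and vanishes at the maximiser, where its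
  first variation is therefore zero.\<close>
lemma radius_exists:
  assumes "V \<noteq> {}" "\<alpha> \<le> 1"
  obtains r where "is_alpha_radius \<alpha> V E r"
proof -
  define I :: "'a \<Rightarrow> real set" where "I = (\<lambda>v. if v \<in> V then {0..1} else {0})"
  \<comment> \<open>Vectors are extended by zero outside \<open>V\<close>, so that compactness is Tychonoff's theorem.\<close>
  define S where "S = PiE UNIV I \<inter> {x. (\<Sum>v\<in>V. (x v)\<^sup>2) = 1}"
  have "compactin (product_topology (\<lambda>_. euclidean) UNIV) (PiE UNIV I)"
    unfolding compactin_PiE I_def by simp
  then have "compact (PiE UNIV I)"
    by (simp add: euclidean_product_topology)
  moreover have "closed {x :: 'a \<Rightarrow> real. (\<Sum>v\<in>V. (x v)\<^sup>2) = 1}"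
    by (intro closed_Collect_eq continuous_intros) auto
  ultimately have S: "compact S" unfolding S_def by (rule compact_Int_closed)
  obtain v0 where v0: "v0 \<in> V" using assms by auto
  have "(\<lambda>v. if v = v0 then 1 else 0) \<in> S"
    unfolding S_def I_def using v0 finite_V by (auto simp: if_distrib[of "\<lambda>x. x\<^sup>2"] cong: if_cong)
  then have ne: "S \<noteq> {}" by auto
  have "continuous_on S (alpha_form \<alpha> E)"
    unfolding alpha_form_def case_prod_beta
    by (intro continuous_intros continuous_on_subset[OF continuous_on_product_coordinates]) auto
  then obtain x where x: "x \<in> S" and max: "\<And>y. y \<in> S \<Longrightarrow> alpha_form \<alpha> E y \<le> alpha_form \<alpha> E x"
    using continuous_attains_sup[OF S ne] by blast
  define r where "r = alpha_form \<alpha> E x"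
  have nx: "(\<Sum>v\<in>V. (x v)\<^sup>2) = 1" using x unfolding S_def by simp
  have x0: "0 \<le> x v" for v using x unfolding S_def I_def PiE_UNIV_domain Pi_def
    by (auto split: if_splits)
  have bound: "alpha_form \<alpha> E y \<le> r * (\<Sum>v\<in>V. (y v)\<^sup>2)" for y
  proof (cases "(\<Sum>v\<in>V. (y v)\<^sup>2) = 0")
    case True
    then have "\<And>v. v \<in> V \<Longrightarrow> y v = 0" using finite_V by (simp add: sum_nonneg_eq_0_iff)
    then have "alpha_form \<alpha> E y = alpha_form \<alpha> E (\<lambda>v. 0)" by (intro form_cong) auto
    then show ?thesis using True by (simp add: alpha_form_def)
  next
    case False
    define q where "q = sqrt (\<Sum>v\<in>V. (y v)\<^sup>2)"
    have q2: "q\<^sup>2 = (\<Sum>v\<in>V. (y v)\<^sup>2)" unfolding q_def by (simp add: sum_nonneg)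
    have "(\<Sum>v\<in>V. (y v)\<^sup>2) \<ge> 0" by (simp add: sum_nonneg)
    with False have q: "q > 0" unfolding q_def by simp
    define z where "z = (\<lambda>v. if v \<in> V then (1 / q) * \<bar>y v\<bar> else 0)"
    have z2: "(\<Sum>v\<in>V. (z v)\<^sup>2) = 1"
    proof -
      have "(\<Sum>v\<in>V. (z v)\<^sup>2) = (\<Sum>v\<in>V. (y v)\<^sup>2) / q\<^sup>2"
        unfolding z_def sum_divide_distrib by (intro sum.cong) (auto simp: power_divide)
      then show ?thesis using q2 q False by simp
    qed
    have "z v \<le> 1" if "v \<in> V" for v
    proof -
      have "(z v)\<^sup>2 \<le> 1" unfolding z2[symmetric]
        using that finite_V by (intro member_le_sum) auto
      then show ?thesis using power2_le_imp_le[of "z v" 1] by simp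
    qed
    then have "z \<in> S" unfolding S_def I_def using z2 q by (auto simp: z_def)
    have "alpha_form \<alpha> E z = alpha_form \<alpha> E (\<lambda>v. (1 / q) * \<bar>y v\<bar>)"
      by (rule form_cong) (simp add: z_def)
    also have "\<dots> = (1 / q)\<^sup>2 * alpha_form \<alpha> E (\<lambda>v. \<bar>y v\<bar>)" by (rule form_scale)
    finally have "(1 / q)\<^sup>2 * alpha_form \<alpha> E (\<lambda>v. \<bar>y v\<bar>) \<le> r"
      using max[OF \<open>z \<in> S\<close>] unfolding r_def by simp
    then have "alpha_form \<alpha> E (\<lambda>v. \<bar>y v\<bar>) \<le> r * q\<^sup>2" using q by (simp add: field_simps)
    then show ?thesis using form_le_abs[OF assms(2), of y] q2 by simp
  qed
  have eig: "alpha_op \<alpha> E x u = r * x u" if u: "u \<in> V" for u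
  proof -
    define e where "e = (\<lambda>v. if v = u then 1 else 0 :: real)"
    define b where "b = r * x u - alpha_op \<alpha> E x u"
    define c where "c = r - alpha_form \<alpha> E e"
    have se: "(\<Sum>v\<in>V. e v * f v) = f u" for f
      unfolding e_def using u finite_V by (simp add: if_distrib[of "\<lambda>x. x * _"] cong: if_cong)
    have ee: "(\<Sum>v\<in>V. (e v)\<^sup>2) = 1" using se[of e] by (simp add: power2_eq_square e_def)
    have quad: "0 \<le> 2 * t * b + t\<^sup>2 * c" for t
    proof -
      have "(\<Sum>v\<in>V. (x v + t * e v)\<^sup>2)
          = (\<Sum>v\<in>V. (x v)\<^sup>2) + 2 * t * (\<Sum>v\<in>V. e v * x v) + t\<^sup>2 * (\<Sum>v\<in>V. (e v)\<^sup>2)"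
        by (simp add: sum.distrib sum_distrib_left algebra_simps power2_eq_square)
      then have "(\<Sum>v\<in>V. (x v + t * e v)\<^sup>2) = 1 + 2 * t * x u + t\<^sup>2"
        by (simp add: se ee nx)
      then show ?thesis
        using bound[of "\<lambda>v. x v + t * e v"] unfolding form_add se b_def c_def r_def
        by (simp add: algebra_simps)
    qed
    have "b = 0"
    proof (rule ccontr)
      assume "b \<noteq> 0"
      define d where "d = \<bar>c\<bar> + 1"
      have d: "d > 0" "c \<le> d" unfolding d_def by auto
      have "0 \<le> 2 * (- b / d) * b + (- b / d)\<^sup>2 * c" by (rule quad)
      also have "\<dots> \<le> 2 * (- b / d) * b + (- b / d)\<^sup>2 * d"
        using d by (intro add_left_mono mult_left_mono) auto
      also have "\<dots> = - (b\<^sup>2 / d)" using d by (simp add: field_simps power2_eq_square)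
      also have "\<dots> < 0" using d \<open>b \<noteq> 0\<close> by simp
      finally show False by simp
    qed
    then show ?thesis unfolding b_def by simp
  qed
  have "\<exists>v\<in>V. x v \<noteq> 0"
    using nx by (metis (mono_tags, lifting) sum.neutral zero_neq_one zero_power2)
  then have "is_alpha_radius \<alpha> V E r"
    unfolding is_alpha_radius_def using bound x0 eig by blast
  then show thesis by (rule that)
qed

text \<open>A positive eigenvector belongs to the largest eigenvalue, because it cannot be orthogonal to a
  nonnegative nonzero eigenvector.\<close>
lemma radius_of_positive_eigenvector:
  assumes "is_alpha_radius \<alpha> V E r"
    and "\<And>v. v \<in> V \<Longrightarrow> alpha_op \<alpha> E y v = s * y v" and "\<And>v. v \<in> V \<Longrightarrow> 0 < y v"
  shows "r = s"
proof -
  obtain x where x: "\<And>v. 0 \<le> x v" "\<exists>v\<in>V. x v \<noteq> 0" "\<And>v. v \<in> V \<Longrightarrow> alpha_op \<alpha> E x v = r * x v"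
    using assms(1) unfolding is_alpha_radius_def by blast
  have "r * (\<Sum>v\<in>V. x v * y v) = (\<Sum>v\<in>V. y v * alpha_op \<alpha> E x v)"
    using x(3) by (simp add: sum_distrib_left algebra_simps)
  also have "\<dots> = s * (\<Sum>v\<in>V. x v * y v)"
    unfolding op_sym[of y] using assms(2) by (simp add: sum_distrib_left algebra_simps)
  finally have "r * (\<Sum>v\<in>V. x v * y v) = s * (\<Sum>v\<in>V. x v * y v)" .
  moreover have "(\<Sum>v\<in>V. x v * y v) > 0"
  proof -
    obtain v where v: "v \<in> V" "x v \<noteq> 0" using x(2) by blast
    have "x v * y v > 0" using v x(1)[of v] assms(3)[of v] by simp
    moreover have "\<And>u. u \<in> V \<Longrightarrow> 0 \<le> x u * y u" using x(1) assms(3) by (simp add: less_imp_le)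
    ultimately show ?thesis using finite_V v(1) by (intro sum_pos2[of _ v]) auto
  qed
  ultimately show ?thesis by simp
qed

end

section \<open>The spectrum\<close>

lemma pair_graph_fin_graph:
  assumes "pair_graph G" shows "fin_graph (pverts G) (parcs G)"
proof -
  interpret pair_graph G by fact
  show ?thesis
  proof
    show "finite (pverts G)" by simp
    show "parcs G \<subseteq> pverts G \<times> pverts G" using in_arcsD1 in_arcsD2 by auto
    show "(v, u) \<in> parcs G" if "(u, v) \<in> parcs G" for u v
      using that sym_arcs by (auto simp: symmetric_def elim: symE)
    show "(v, v) \<notin> parcs G" for v using no_loops by fastforce
  qed
qed

text \<open>The rows of the matrix are numbered by \<open>vertex_list\<close>, which enumerates the vertices without
  repetition; this turns the matrix-vector product into \<open>alpha_op\<close>.\<close>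
lemma A_alpha_mult_vec:
  assumes G: "pair_graph G" and i: "i < card (pverts G)"
  shows "(A_alpha \<alpha> G *\<^sub>v vec (card (pverts G)) (\<lambda>i. x (vertex_list G ! i))) $ i
    = alpha_op \<alpha> (parcs G) x (vertex_list G ! i)"
proof -
  interpret fin_graph "pverts G" "parcs G" by (rule pair_graph_fin_graph[OF G])
  let ?n = "card (pverts G)" and ?l = "vertex_list G"
  have len: "length ?l = ?n" and dis: "distinct ?l" and st: "set ?l = pverts G"
    using finite_V by (auto simp: vertex_list_def)
  have bij: "bij_betw (\<lambda>j. ?l ! j) {..<?n} (pverts G)"
    using bij_betw_nth[OF dis, of "{..<?n}"] len st by simp
  let ?u = "?l ! i"
  have "(A_alpha \<alpha> G *\<^sub>v vec ?n (\<lambda>i. x (?l ! i))) $ i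
      = (\<Sum>j<?n. (if i = j then \<alpha> * real (out_degree (with_proj G) ?u) * x (?l ! j) else 0)
           + (1 - \<alpha>) * ((if (?u, ?l ! j) \<in> parcs G then 1 else 0) * x (?l ! j)))"
    using i by (auto simp: A_alpha_def degree_matrix_def adjacency_matrix_def scalar_prod_def
        atLeast0LessThan algebra_simps intro!: sum.cong)
  also have "\<dots> = \<alpha> * real (out_degree (with_proj G) ?u) * x ?u
      + (1 - \<alpha>) * (\<Sum>j<?n. (if (?u, ?l ! j) \<in> parcs G then 1 else 0) * x (?l ! j))"
    using i by (simp add: sum.distrib sum_distrib_left)
  also have "(\<Sum>j<?n. (if (?u, ?l ! j) \<in> parcs G then 1 else 0) * x (?l ! j))
      = (\<Sum>w\<in>pverts G. (if (?u, w) \<in> parcs G then 1 else 0) * x w)"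
    by (rule sum.reindex_bij_betw[OF bij])
  also have "\<dots> = (\<Sum>w\<in>parcs G `` {?u}. x w)"
    using nbhd_sub finite_V by (intro sum.mono_neutral_cong_right) auto
  also have "out_degree (with_proj G) ?u = deg (parcs G) ?u"
  proof -
    have "out_arcs (with_proj G) ?u = Pair ?u ` (parcs G `` {?u})"
      by (auto simp: out_arcs_def)
    then show ?thesis
      by (simp add: out_degree_def deg_def card_image inj_on_def)
  qed
  finally show ?thesis by (simp add: alpha_op_def)
qed

lemma eigenvalue_A_alpha_iff:
  assumes G: "pair_graph G"
  shows "eigenvalue (A_alpha \<alpha> G) c \<longleftrightarrow>
    (\<exists>x. (\<exists>v\<in>pverts G. x v \<noteq> 0) \<and> (\<forall>v\<in>pverts G. alpha_op \<alpha> (parcs G) x v = c * x v))"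
proof -
  interpret fin_graph "pverts G" "parcs G" by (rule pair_graph_fin_graph[OF G])
  let ?n = "card (pverts G)" and ?l = "vertex_list G" and ?A = "A_alpha \<alpha> G"
  have len: "length ?l = ?n" and dis: "distinct ?l" and st: "set ?l = pverts G"
    using finite_V by (auto simp: vertex_list_def)
  have all_l: "(\<forall>v\<in>pverts G. P v) \<longleftrightarrow> (\<forall>i<?n. P (?l ! i))" for P
    using len st by (metis all_set_conv_all_nth)
  have dim: "dim_row ?A = ?n"
    by (simp add: A_alpha_def degree_matrix_def adjacency_matrix_def)
  have ev: "eigenvector ?A (vec ?n (\<lambda>i. x (?l ! i))) c \<longleftrightarrow>
    (\<exists>v\<in>pverts G. x v \<noteq> 0) \<and> (\<forall>v\<in>pverts G. alpha_op \<alpha> (parcs G) x v = c * x v)" for x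
  proof -
    have "vec ?n (\<lambda>i. x (?l ! i)) = 0\<^sub>v ?n \<longleftrightarrow> (\<forall>v\<in>pverts G. x v = 0)"
      unfolding all_l by (auto simp: vec_eq_iff)
    moreover have "?A *\<^sub>v vec ?n (\<lambda>i. x (?l ! i)) = c \<cdot>\<^sub>v vec ?n (\<lambda>i. x (?l ! i)) \<longleftrightarrow>
        (\<forall>v\<in>pverts G. alpha_op \<alpha> (parcs G) x v = c * x v)"
      unfolding all_l vec_eq_iff using dim
      by (auto simp: A_alpha_mult_vec[OF G] simp del: index_mult_mat_vec)
    ultimately show ?thesis by (auto simp: eigenvector_def dim)
  qed
  show ?thesis
  proof
    assume "eigenvalue ?A c"
    then obtain y where y: "eigenvector ?A y c" by (auto simp: eigenvalue_def)
    define x where "x = (\<lambda>v. y $ (the_inv_into {..<?n} (\<lambda>i. ?l ! i) v))"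
    have "inj_on (\<lambda>i. ?l ! i) {..<?n}" using dis len by (auto simp: inj_on_def nth_eq_iff_index_eq)
    then have "y = vec ?n (\<lambda>i. x (?l ! i))"
      using y by (intro eq_vecI) (auto simp: x_def the_inv_into_f_f eigenvector_def dim)
    with y ev show "\<exists>x. (\<exists>v\<in>pverts G. x v \<noteq> 0) \<and> (\<forall>v\<in>pverts G. alpha_op \<alpha> (parcs G) x v = c * x v)"
      by metis
  next
    assume "\<exists>x. (\<exists>v\<in>pverts G. x v \<noteq> 0) \<and> (\<forall>v\<in>pverts G. alpha_op \<alpha> (parcs G) x v = c * x v)"
    with ev show "eigenvalue ?A c" unfolding eigenvalue_def by metis
  qed
qed

lemma rho_alpha_is_radius:
  assumes G: "pair_graph G" and ne: "pverts G \<noteq> {}" and \<alpha>: "\<alpha> \<le> 1"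
  shows "is_alpha_radius \<alpha> (pverts G) (parcs G) (rho_alpha \<alpha> G)"
proof -
  interpret fin_graph "pverts G" "parcs G" by (rule pair_graph_fin_graph[OF G])
  obtain r where r: "is_alpha_radius \<alpha> (pverts G) (parcs G) r"
    using radius_exists[OF ne \<alpha>] by blast
  have "A_alpha \<alpha> G \<in> carrier_mat (card (pverts G)) (card (pverts G))"
    by (simp add: A_alpha_def degree_matrix_def adjacency_matrix_def)
  then have fin: "finite (spectrum (A_alpha \<alpha> G))" by (rule card_finite_spectrum)
  have "rho_alpha \<alpha> G = r"
    unfolding rho_alpha_def
  proof (rule Max_eqI[OF fin])
    show "s \<le> r" if "s \<in> spectrum (A_alpha \<alpha> G)" for s
      using that radius_bound_eigenvalue[OF r]
      by (auto simp: spectrum_def eigenvalue_A_alpha_iff[OF G])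
    show "r \<in> spectrum (A_alpha \<alpha> G)"
      using r by (auto simp: spectrum_def eigenvalue_A_alpha_iff[OF G] is_alpha_radius_def)
  qed
  with r show ?thesis by simp
qed

section \<open>Linear forests as subgraphs\<close>

text \<open>\<open>ps i\<close>, for \<open>i\<close> in \<open>I\<close>, lists the vertices of a path on \<open>k i\<close> vertices inside \<open>X\<close>, and these paths are
  pairwise disjoint.\<close>
definition packs_paths ::
  "'a rel \<Rightarrow> 'i set \<Rightarrow> ('i \<Rightarrow> nat) \<Rightarrow> 'a set \<Rightarrow> ('i \<Rightarrow> 'a list) \<Rightarrow> bool" where
  "packs_paths E I k X ps \<longleftrightarrow>
     (\<forall>i\<in>I. length (ps i) = k i \<and> distinct (ps i) \<and> set (ps i) \<subseteq> X
        \<and> successively (\<lambda>u v. (u, v) \<in> E) (ps i)) \<and>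
     (\<forall>i\<in>I. \<forall>j\<in>I. i \<noteq> j \<longrightarrow> set (ps i) \<inter> set (ps j) = {})"

text \<open>The linear forest with components \<open>P\<^bsub>k i\<^esub>\<close> is a (not necessarily induced) subgraph on vertices
  from \<open>X\<close>.\<close>
definition has_forest :: "'a rel \<Rightarrow> 'i set \<Rightarrow> ('i \<Rightarrow> nat) \<Rightarrow> 'a set \<Rightarrow> bool" where
  "has_forest E I k X \<longleftrightarrow> (\<exists>ps. packs_paths E I k X ps)"

lemma packs_paths_insert:
  assumes "packs_paths E I k X ps" "i \<notin> I"
    and "length ys = k i" "distinct ys" "set ys \<subseteq> X" "successively (\<lambda>u v. (u, v) \<in> E) ys"
    and "set ys \<inter> (\<Union>j\<in>I. set (ps j)) = {}"
  shows "packs_paths E (insert i I) k X (ps(i := ys))"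
  using assms unfolding packs_paths_def by (auto simp: disjoint_iff)

lemma packs_paths_mono: "packs_paths E I k X ps \<Longrightarrow> X \<subseteq> Y \<Longrightarrow> packs_paths E I k Y ps"
  unfolding packs_paths_def by blast

lemma has_forest_mono: "has_forest E I k X \<Longrightarrow> X \<subseteq> Y \<Longrightarrow> has_forest E I k Y"
  unfolding has_forest_def using packs_paths_mono by blast

lemma has_forest_insert:
  assumes "has_forest E I k X" "i \<notin> I"
    and "length ys = k i" "distinct ys" "successively (\<lambda>u v. (u, v) \<in> E) ys" "set ys \<inter> X = {}"
  shows "has_forest E (insert i I) k (X \<union> set ys)"
proof -
  obtain ps where ps: "packs_paths E I k X ps" using assms(1) unfolding has_forest_def by blast
  then have "(\<Union>j\<in>I. set (ps j)) \<subseteq> X" unfolding packs_paths_def by blast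
  with assms have "packs_paths E (insert i I) k (X \<union> set ys) (ps(i := ys))"
    by (intro packs_paths_insert packs_paths_mono[OF ps]) auto
  then show ?thesis unfolding has_forest_def by blast
qed

text \<open>A path that continues a path ending in \<open>x\<close> and alternates between \<open>C\<close> and \<open>T\<close>, starting in \<open>C\<close>.\<close>
lemma alternating_path:
  assumes "finite C" "finite T" "card C = j" "card T = j" "C \<inter> T = {}"
    and "\<And>c t. c \<in> C \<Longrightarrow> t \<in> T \<Longrightarrow> (c, t) \<in> E \<and> (t, c) \<in> E"
    and "\<And>c. c \<in> C \<Longrightarrow> (x, c) \<in> E"
  shows "\<exists>ys. length ys = 2 * j \<and> distinct ys \<and> set ys = C \<union> T
    \<and> successively (\<lambda>u v. (u, v) \<in> E) (x # ys)"
  using assms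
proof (induction j arbitrary: x C T)
  case 0
  then show ?case by simp
next
  case (Suc j)
  obtain c where c: "c \<in> C" using Suc.prems(3) by fastforce
  obtain t where t: "t \<in> T" using Suc.prems(4) by fastforce
  have "\<exists>ys. length ys = 2 * j \<and> distinct ys \<and> set ys = (C - {c}) \<union> (T - {t})
    \<and> successively (\<lambda>u v. (u, v) \<in> E) (t # ys)"
    using Suc.prems c t by (intro Suc.IH) auto
  then obtain ys where ys: "length ys = 2 * j" "distinct ys" "set ys = (C - {c}) \<union> (T - {t})"
    "successively (\<lambda>u v. (u, v) \<in> E) (t # ys)" by blast
  have "distinct (c # t # ys)" using ys c t Suc.prems(5) by auto
  moreover have "set (c # t # ys) = C \<union> T" using ys c t by auto
  moreover have "successively (\<lambda>u v. (u, v) \<in> E) (x # c # t # ys)"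
    using ys(4) Suc.prems(6)[OF c t] Suc.prems(7)[OF c] by simp
  moreover have "length (c # t # ys) = 2 * Suc j" using ys by simp
  ultimately show ?case by blast
qed

lemma path_in_complete_bipartite:
  assumes "finite C" "finite T" "card C = k div 2" "card T = k - k div 2" "2 \<le> k" "C \<inter> T = {}"
    and E: "\<And>c t. c \<in> C \<Longrightarrow> t \<in> T \<Longrightarrow> (c, t) \<in> E \<and> (t, c) \<in> E"
  shows "\<exists>ys. length ys = k \<and> distinct ys \<and> set ys = C \<union> T \<and> successively (\<lambda>u v. (u, v) \<in> E) ys"
proof -
  have "k div 2 < k" using assms(5) by (intro div_less_dividend) auto
  then have "card T \<noteq> 0" using assms(4) by linarith
  then obtain t where t: "t \<in> T" by fastforce
  show ?thesis
  proof (cases "even k")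
    case True
    then have "card T = k div 2" using assms(4) by (auto elim!: evenE)
    then obtain ys where "length ys = 2 * (k div 2)" "distinct ys" "set ys = C \<union> T"
      "successively (\<lambda>u v. (u, v) \<in> E) (t # ys)"
      using alternating_path[of C T "k div 2" E t] assms(1-3,6) t E by metis
    then show ?thesis using True by (auto simp: successively_Cons)
  next
    case False
    then have "card (T - {t}) = k div 2" using assms(4) t
      by (auto simp: card_Diff_singleton elim!: oddE)
    then have "\<exists>ys. length ys = 2 * (k div 2) \<and> distinct ys \<and> set ys = C \<union> (T - {t})
      \<and> successively (\<lambda>u v. (u, v) \<in> E) (t # ys)"
      using assms(1-3,6) t E by (intro alternating_path) auto
    then obtain ys where ys: "length ys = 2 * (k div 2)" "distinct ys" "set ys = C \<union> (T - {t})"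
      "successively (\<lambda>u v. (u, v) \<in> E) (t # ys)" by blast
    have "distinct (t # ys)" "set (t # ys) = C \<union> T" using ys t assms(6) by auto
    moreover have "length (t # ys) = k" using ys(1) False by (auto elim!: oddE)
    ultimately show ?thesis using ys(4) by blast
  qed
qed

text \<open>A path on \<open>k\<close> vertices uses \<open>\<lfloor>k/2\<rfloor>\<close> vertices of \<open>C\<close> (the centres) and the remaining ones from \<open>T\<close>.\<close>
lemma forest_in_complete_bipartite:
  assumes "finite I" "finite C" "finite T" "C \<inter> T = {}"
    and "\<And>c t. c \<in> C \<Longrightarrow> t \<in> T \<Longrightarrow> (c, t) \<in> E \<and> (t, c) \<in> E"
    and "\<And>i. i \<in> I \<Longrightarrow> 2 \<le> k i"
    and "(\<Sum>i\<in>I. k i div 2) \<le> card C" and "(\<Sum>i\<in>I. k i - k i div 2) \<le> card T"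
  shows "has_forest E I k (C \<union> T)"
  using assms
proof (induction I arbitrary: C T rule: finite_induct)
  case empty
  then show ?case by (simp add: has_forest_def packs_paths_def)
next
  case (insert i I)
  define a b where "a = (\<lambda>i. k i div 2)" and "b = (\<lambda>i. k i - k i div 2)"
  have cards: "a i + (\<Sum>i\<in>I. a i) \<le> card C" "b i + (\<Sum>i\<in>I. b i) \<le> card T"
    using insert.prems(6,7) insert.hyps unfolding a_def b_def by (simp_all only: sum.insert not_False_eq_True)
  obtain C1 where C1: "C1 \<subseteq> C" "card C1 = a i" "finite C1"
    using obtain_subset_with_card_n[of "a i" C] cards(1) by auto
  obtain T1 where T1: "T1 \<subseteq> T" "card T1 = b i" "finite T1"
    using obtain_subset_with_card_n[of "b i" T] cards(2) by auto
  have "\<exists>ys. length ys = k i \<and> distinct ys \<and> set ys = C1 \<union> T1 \<and> successively (\<lambda>u v. (u, v) \<in> E) ys"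
  proof (rule path_in_complete_bipartite)
    show "(c, t) \<in> E \<and> (t, c) \<in> E" if "c \<in> C1" "t \<in> T1" for c t
      using that C1(1) T1(1) insert.prems(4) by blast
  qed (use C1 T1 insert.prems(3,5) in \<open>auto simp: a_def b_def\<close>)
  then obtain ys where ys: "length ys = k i" "distinct ys" "set ys = C1 \<union> T1"
    "successively (\<lambda>u v. (u, v) \<in> E) ys" by blast
  have "has_forest E I k ((C - C1) \<union> (T - T1))"
  proof (rule insert.IH)
    show "(\<Sum>i\<in>I. k i div 2) \<le> card (C - C1)" "(\<Sum>i\<in>I. k i - k i div 2) \<le> card (T - T1)"
      using cards C1 T1 unfolding a_def b_def by (simp_all only: card_Diff_subset)
  qed (use insert.prems in auto)
  then have "has_forest E (insert i I) k ((C - C1) \<union> (T - T1) \<union> set ys)"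
    using ys insert.hyps insert.prems(3) C1 T1 by (intro has_forest_insert) auto
  moreover have "(C - C1) \<union> (T - T1) \<union> set ys = C \<union> T" using ys C1 T1 by auto
  ultimately show ?case by simp
qed

context fin_graph
begin

text \<open>The path is grown at its head; \<open>U\<close> is a set of vertices to be avoided.\<close>
lemma greedy_path:
  assumes "X \<subseteq> V" "X \<noteq> {}" "\<And>v. v \<in> X \<Longrightarrow> N \<le> card (E `` {v} \<inter> X)" "finite U" "card U + m \<le> N"
  shows "\<exists>ys. length ys = m \<and> distinct ys \<and> set ys \<subseteq> X - U \<and> successively (\<lambda>u v. (u, v) \<in> E) ys"
  using assms(5)
proof (induction m)
  case 0
  then show ?case by simp
next
  case (Suc m)
  then obtain ys where ys: "length ys = m" "distinct ys" "set ys \<subseteq> X - U"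
    "successively (\<lambda>u v. (u, v) \<in> E) ys" by auto
  obtain v0 where v0: "v0 \<in> X" using assms(2) by auto
  define v where "v = (if ys = [] then v0 else hd ys)"
  have "hd ys \<in> X" if "ys \<noteq> []" using hd_in_set[OF that] ys(3) by blast
  then have v: "v \<in> X" using v0 unfolding v_def by simp
  have "card (U \<union> set ys) < card (E `` {v} \<inter> X)"
    using assms(3)[OF v] Suc.prems ys(1) card_Un_le[of U "set ys"] card_length[of ys] by simp
  then have "\<not> E `` {v} \<inter> X \<subseteq> U \<union> set ys"
    using assms(4) by (meson card_mono finite_UnI List.finite_set not_le)
  then obtain w where w: "(v, w) \<in> E" "w \<in> X" "w \<notin> U" "w \<notin> set ys" by auto
  have "successively (\<lambda>u v. (u, v) \<in> E) (w # ys)"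
    using ys(4) E_sym[OF w(1)] by (auto simp: successively_Cons v_def split: if_splits)
  then show ?case using ys w by (intro exI[of _ "w # ys"]) auto
qed

lemma forest_of_min_degree:
  assumes "X \<subseteq> V" "X \<noteq> {}" "\<And>v. v \<in> X \<Longrightarrow> N \<le> card (E `` {v} \<inter> X)"
    and "finite I" "(\<Sum>i\<in>I. k i) \<le> N"
  shows "has_forest E I k X"
  using assms(4,5)
proof (induction I rule: finite_induct)
  case empty
  then show ?case by (simp add: has_forest_def packs_paths_def)
next
  case (insert i I)
  then obtain ps where ps: "packs_paths E I k X ps" unfolding has_forest_def by auto
  define U where "U = (\<Union>j\<in>I. set (ps j))"
  have "card U \<le> (\<Sum>j\<in>I. card (set (ps j)))"
    unfolding U_def using insert.hyps by (intro card_UN_le)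
  also have "\<dots> \<le> (\<Sum>j\<in>I. k j)"
    using ps unfolding packs_paths_def by (intro sum_mono) (metis card_length)
  finally have "card U + k i \<le> N" using insert by simp
  moreover have "finite U" unfolding U_def using insert.hyps by simp
  ultimately obtain ys where "length ys = k i" "distinct ys" "set ys \<subseteq> X - U"
    "successively (\<lambda>u v. (u, v) \<in> E) ys"
    using greedy_path[OF assms(1-3)] by blast
  then have "packs_paths E (insert i I) k X (ps(i := ys))"
    using insert.hyps by (intro packs_paths_insert ps) (auto simp: U_def)
  then show ?case unfolding has_forest_def by blast
qed

text \<open>Graphs without the forest are degenerate: every induced subgraph has a vertex of degree less than
  the order of the forest. Removing such vertices one by one bounds the degree sum.\<close>
lemma degree_sum_induced:
  assumes "\<not> has_forest E I k V" "finite I" "X \<subseteq> V"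
  shows "(\<Sum>v\<in>X. card (E `` {v} \<inter> X)) \<le> 2 * (\<Sum>i\<in>I. k i) * card X"
  using assms(3)
proof (induction "card X" arbitrary: X)
  case 0
  then have "X = {}" using finite_V by (metis card_eq_0_iff finite_subset)
  then show ?case by simp
next
  case (Suc m)
  let ?N = "\<Sum>i\<in>I. k i"
  have fX: "finite X" using Suc.prems finite_V by (rule finite_subset)
  have "X \<noteq> {}" using Suc.hyps(2) by auto
  then obtain v where v: "v \<in> X" "card (E `` {v} \<inter> X) < ?N"
    using forest_of_min_degree[OF Suc.prems _ _ assms(2) order_refl] assms(1) has_forest_mono[OF _ Suc.prems]
    by (meson not_le)
  let ?Y = "X - {v}"
  have m: "m = card ?Y" using Suc.hyps(2) v(1) fX by simp
  have split: "card (E `` {u} \<inter> X) = card (E `` {u} \<inter> ?Y) + (if (u, v) \<in> E then 1 else 0)" for u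
  proof (cases "(u, v) \<in> E")
    case True
    then have "E `` {u} \<inter> X = insert v (E `` {u} \<inter> ?Y)" using v by auto
    then show ?thesis using True fX by simp
  next
    case False
    then have "E `` {u} \<inter> X = E `` {u} \<inter> ?Y" by auto
    then show ?thesis using False by simp
  qed
  have "{u \<in> ?Y. (u, v) \<in> E} = E `` {v} \<inter> X"
    using E_irrefl by (auto intro: E_sym)
  then have last: "(\<Sum>u\<in>?Y. if (u, v) \<in> E then 1 else 0) = card (E `` {v} \<inter> X)"
    using fX by (simp add: sum.If_cases Int_def)
  have "(\<Sum>u\<in>X. card (E `` {u} \<inter> X)) = card (E `` {v} \<inter> X) + (\<Sum>u\<in>?Y. card (E `` {u} \<inter> X))"
    using fX v(1) by (rule sum.remove)
  also have "(\<Sum>u\<in>?Y. card (E `` {u} \<inter> X)) = (\<Sum>u\<in>?Y. card (E `` {u} \<inter> ?Y)) + card (E `` {v} \<inter> X)"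
    unfolding last[symmetric] sum.distrib[symmetric] by (intro sum.cong refl split)
  also have "card (E `` {v} \<inter> X) + ((\<Sum>u\<in>?Y. card (E `` {u} \<inter> ?Y)) + card (E `` {v} \<inter> X))
      = 2 * card (E `` {v} \<inter> X) + (\<Sum>u\<in>?Y. card (E `` {u} \<inter> ?Y))" by simp
  also have "\<dots> \<le> 2 * ?N + 2 * ?N * card ?Y"
    using v(2) Suc.hyps(1)[OF m] Suc.prems by (intro add_mono) auto
  also have "\<dots> = 2 * ?N * card X" using m Suc.hyps(2)[symmetric] by simp
  finally show ?case .
qed

lemma degree_sum_le:
  assumes "\<not> has_forest E I k V" "finite I"
  shows "(\<Sum>v\<in>V. deg E v) \<le> 2 * (\<Sum>i\<in>I. k i) * card V"
proof -
  have "E `` {v} \<inter> V = E `` {v}" for v using nbhd_sub by auto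
  then show ?thesis using degree_sum_induced[OF assms order_refl] by (simp add: deg_def)
qed

lemma forest_of_common_neighbours:
  assumes "C \<subseteq> V" "T \<subseteq> V" "\<And>c t. c \<in> C \<Longrightarrow> t \<in> T \<Longrightarrow> (c, t) \<in> E"
    and "finite I" "\<And>i. i \<in> I \<Longrightarrow> 2 \<le> k i"
    and "(\<Sum>i\<in>I. k i div 2) \<le> card C" and "(\<Sum>i\<in>I. k i) \<le> card T"
  shows "has_forest E I k V"
proof -
  have "(\<Sum>i\<in>I. k i - k i div 2) \<le> (\<Sum>i\<in>I. k i)" by (intro sum_mono) simp
  moreover have "C \<inter> T = {}" using assms(3) E_irrefl by blast
  moreover have "(c, t) \<in> E \<and> (t, c) \<in> E" if "c \<in> C" "t \<in> T" for c t
    using assms(3)[OF that] E_sym by blast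
  moreover have "finite C" "finite T" using assms(1,2) finite_V by (auto intro: finite_subset)
  ultimately have "has_forest E I k (C \<union> T)"
    using assms(4-7) by (intro forest_in_complete_bipartite) simp_all
  then show ?thesis by (rule has_forest_mono) (use assms(1,2) in auto)
qed

end

text \<open>Every vertex of \<open>M\<close> is adjacent to all other vertices of the graph.\<close>
definition dominating :: "'a set \<Rightarrow> 'a rel \<Rightarrow> 'a set \<Rightarrow> bool" where
  "dominating V E M \<longleftrightarrow> M \<subseteq> V \<and> (\<forall>u\<in>M. \<forall>v\<in>V. u \<noteq> v \<longrightarrow> (u, v) \<in> E)"

context fin_graph
begin

text \<open>If the dominating set \<open>M\<close> is at most one vertex short of the number of centres that the forest needs,
  then it suffices to start one of the paths with a segment \<open>P\<close> such that this path visits at least one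
  centre fewer than it otherwise would. The path continues from the end of \<open>P\<close> by alternating \<open>j\<close> times
  between \<open>M\<close> and the rest.\<close>
lemma forest_of_start:
  assumes M: "dominating V E M" and I: "finite I" "i \<in> I" "\<And>i. i \<in> I \<Longrightarrow> 2 \<le> k i"
    and P: "set P \<subseteq> V" "distinct P" "P \<noteq> []" "last P \<notin> M" "successively (\<lambda>u v. (u, v) \<in> E) P"
    and len: "length P + 2 * j = k i"
    and cen: "card (set P \<inter> M) + j + 1 \<le> k i div 2" "(\<Sum>i\<in>I. k i div 2) \<le> card M + 1"
    and large: "2 * (\<Sum>i\<in>I. k i) + card M \<le> card V"
  shows "has_forest E I k V"
proof -
  have MV: "M \<subseteq> V" and fM: "finite M" using M finite_V unfolding dominating_def by (auto intro: finite_subset)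
  define C where "C = M - set P"
  define T where "T = V - (M \<union> set P)"
  have adj: "(c, t) \<in> E \<and> (t, c) \<in> E" if "c \<in> C" "t \<in> T" for c t
  proof -
    have "(c, t) \<in> E" using that M unfolding dominating_def C_def T_def by auto
    then show ?thesis using E_sym by blast
  qed
  have fin: "finite C" "finite T" "C \<inter> T = {}" unfolding C_def T_def using fM finite_V by auto
  have si: "(\<Sum>i\<in>I. f i) = f i + (\<Sum>i\<in>I - {i}. f i)" for f :: "_ \<Rightarrow> nat"
    using I(1,2) by (rule sum.remove)
  have "card C + card (set P \<inter> M) = card M"
    unfolding C_def using fM by (metis Int_commute add.commute card_Int_Diff)
  then have cC: "j + (\<Sum>i\<in>I - {i}. k i div 2) \<le> card C"
    using cen si[of "\<lambda>i. k i div 2"] by simp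
  have "card V - card (M \<union> set P) \<le> card T" unfolding T_def by (rule diff_card_le_card_Diff) (use fM in auto)
  moreover have "card (M \<union> set P) \<le> card M + k i"
    using card_Un_le[of M "set P"] card_length[of P] len by simp
  ultimately have cT: "j + (\<Sum>i\<in>I - {i}. k i) \<le> card T"
    using large si[of k] len by simp
  obtain C1 where C1: "C1 \<subseteq> C" "card C1 = j" "finite C1"
    using obtain_subset_with_card_n[of j C] cC by auto
  obtain T1 where T1: "T1 \<subseteq> T" "card T1 = j" "finite T1"
    using obtain_subset_with_card_n[of j T] cT by auto
  have lastV: "last P \<in> V" using P by auto
  have "\<exists>ys. length ys = 2 * j \<and> distinct ys \<and> set ys = C1 \<union> T1
    \<and> successively (\<lambda>u v. (u, v) \<in> E) (last P # ys)"
  proof (rule alternating_path)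
    show "(c, t) \<in> E \<and> (t, c) \<in> E" if "c \<in> C1" "t \<in> T1" for c t
      using that C1(1) T1(1) adj by blast
    show "C1 \<inter> T1 = {}" using C1(1) T1(1) fin(3) by blast
    show "(last P, c) \<in> E" if "c \<in> C1" for c
    proof -
      have "c \<in> M" "c \<noteq> last P" using that C1(1) P(4) unfolding C_def by auto
      then have "(c, last P) \<in> E" using M lastV unfolding dominating_def by simp
      then show ?thesis by (rule E_sym)
    qed
  qed (use C1 T1 in simp_all)
  then obtain ys where ys: "length ys = 2 * j" "distinct ys" "set ys = C1 \<union> T1"
    "successively (\<lambda>u v. (u, v) \<in> E) (last P # ys)" by blast
  have path: "successively (\<lambda>u v. (u, v) \<in> E) (P @ ys)"
    using ys(4) P(3,5) by (auto simp: successively_append_iff successively_Cons)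
  have "(\<Sum>i\<in>I - {i}. k i - k i div 2) \<le> (\<Sum>i\<in>I - {i}. k i)" by (intro sum_mono) simp
  then have "has_forest E (I - {i}) k ((C - C1) \<union> (T - T1))"
  proof (intro forest_in_complete_bipartite)
    show "(C - C1) \<inter> (T - T1) = {}" using fin(3) by blast
    show "(c, t) \<in> E \<and> (t, c) \<in> E" if "c \<in> C - C1" "t \<in> T - T1" for c t
      using adj that by blast
    show "(\<Sum>i\<in>I - {i}. k i div 2) \<le> card (C - C1)" using cC C1 by (simp add: card_Diff_subset)
    show "(\<Sum>i\<in>I - {i}. k i - k i div 2) \<le> card (T - T1)"
      using cT T1 \<open>(\<Sum>i\<in>I - {i}. k i - k i div 2) \<le> (\<Sum>i\<in>I - {i}. k i)\<close>
      by (simp add: card_Diff_subset)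
  qed (use I fin in auto)
  then have "has_forest E (insert i (I - {i})) k ((C - C1) \<union> (T - T1) \<union> set (P @ ys))"
    using path ys P len fin C1 T1
    by (intro has_forest_insert) (simp_all add: C_def T_def, blast+)
  moreover have "(C - C1) \<union> (T - T1) \<union> set (P @ ys) \<subseteq> V"
    using C1 T1 P MV ys by (auto simp: C_def T_def)
  moreover have "insert i (I - {i}) = I" using I(2) by blast
  ultimately show ?thesis using has_forest_mono by fastforce
qed

end

section \<open>Stability\<close>

context fin_graph
begin

lemma deg_less: "v \<in> V \<Longrightarrow> deg E v < card V"
proof -
  assume "v \<in> V"
  then have "E `` {v} \<subset> V" using nbhd_sub[of v] E_irrefl by blast
  then show ?thesis unfolding deg_def by (rule psubset_card_mono[OF finite_V])
qed

lemma eigen_total: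
  assumes "\<And>v. v \<in> V \<Longrightarrow> alpha_op \<alpha> E x v = r * x v"
  shows "r * (\<Sum>v\<in>V. x v) = (\<Sum>v\<in>V. real (deg E v) * x v)"
proof -
  have "r * (\<Sum>v\<in>V. x v) = (\<Sum>v\<in>V. 1 * alpha_op \<alpha> E x v)"
    using assms by (simp add: sum_distrib_left)
  also have "\<dots> = (\<Sum>v\<in>V. x v * alpha_op \<alpha> E (\<lambda>_. 1) v)" by (rule op_sym)
  also have "\<dots> = (\<Sum>v\<in>V. real (deg E v) * x v)"
    by (intro sum.cong) (auto simp: alpha_op_def deg_def algebra_simps)
  finally show ?thesis .
qed

lemma normalized_eigenvector:
  assumes "is_alpha_radius \<alpha> V E r"
  obtains x u where "\<And>v. 0 \<le> x v" "\<And>v. v \<in> V \<Longrightarrow> x v \<le> 1" "u \<in> V" "x u = 1"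
    "\<And>v. v \<in> V \<Longrightarrow> alpha_op \<alpha> E x v = r * x v"
proof -
  obtain y where y: "\<And>v. 0 \<le> y v" "\<exists>v\<in>V. y v \<noteq> 0" "\<And>v. v \<in> V \<Longrightarrow> alpha_op \<alpha> E y v = r * y v"
    using assms unfolding is_alpha_radius_def by blast
  define m where "m = Max (y ` V)"
  have "V \<noteq> {}" using y(2) by blast
  then have "m \<in> y ` V" unfolding m_def using finite_V by (intro Max_in) auto
  then obtain u where u: "u \<in> V" "y u = m" by blast
  have le: "y v \<le> m" if "v \<in> V" for v unfolding m_def using that finite_V by simp
  obtain w where "w \<in> V" "y w \<noteq> 0" using y(2) by blast
  then have m: "m > 0" using le[of w] y(1)[of w] by linarith
  show thesis
  proof (rule that[of "\<lambda>v. y v / m" u])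
    show "alpha_op \<alpha> E (\<lambda>v. y v / m) v = r * (y v / m)" if "v \<in> V" for v
    proof -
      have "alpha_op \<alpha> E (\<lambda>v. y v / m) v = alpha_op \<alpha> E y v / m"
        by (simp add: alpha_op_def add_divide_distrib flip: sum_divide_distrib)
      then show ?thesis using y(3)[OF that] by simp
    qed
  qed (use y(1) m u le in auto)
qed

lemma eigen_entry_bound:
  assumes "0 < \<alpha>" "\<alpha> < 1" "\<And>v. 0 \<le> x v" "v \<in> V" "alpha_op \<alpha> E x v = r * x v"
  shows "(r - \<alpha> * real (deg E v)) * x v \<le> (\<Sum>v\<in>V. x v)"
proof -
  have nn: "(\<Sum>w\<in>E `` {v}. x w) \<ge> 0" using assms(3) by (intro sum_nonneg) auto
  have "(r - \<alpha> * real (deg E v)) * x v = (1 - \<alpha>) * (\<Sum>w\<in>E `` {v}. x w)"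
    using assms(5) unfolding alpha_op_def by (simp add: algebra_simps)
  also have "\<dots> \<le> (\<Sum>w\<in>E `` {v}. x w)" using nn assms(1,2) by (intro mult_left_le_one_le) auto
  also have "\<dots> \<le> (\<Sum>v\<in>V. x v)"
    using nbhd_sub finite_V assms(3) by (intro sum_mono2) auto
  finally show ?thesis .
qed

text \<open>The vertices of degree at least \<open>n - K\<close> have total weight more than \<open>p - 1/2\<close>. The constant \<open>B\<close> bounds
  the sum of all entries, \<open>\<eta>\<close> bounds the entries outside \<open>M\<close>, and the slack \<open>e\<close> is chosen such that
  \<open>3e\<close> is \<open>3/8\<close> of \<open>(1 - \<alpha>)/\<alpha>\<close>, the amount by which a unit of weight on \<open>M\<close> raises the
  asymptotic bound on the radius.\<close>
lemma weight_of_large_degrees: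
  fixes \<alpha> r e \<eta> B :: real and p N K :: nat
  defines "n \<equiv> real (card V)"
  defines "M \<equiv> {v \<in> V. card V \<le> deg E v + K}"
  assumes \<alpha>: "0 < \<alpha>" "\<alpha> < 1"
    and x: "\<And>v. 0 \<le> x v" "\<And>v. v \<in> V \<Longrightarrow> x v \<le> 1" "u \<in> V" "x u = 1"
    and eig: "\<And>v. v \<in> V \<Longrightarrow> alpha_op \<alpha> E x v = r * x v"
    and degs: "(\<Sum>v\<in>V. deg E v) \<le> 2 * N * card V"
    and e: "e = (1 - \<alpha>) / (8 * \<alpha>)" and B: "B = 4 * real N / \<alpha>" "0 < B"
    and r: "\<alpha> * n - 1 + real p * (1 - \<alpha>) / \<alpha> - e \<le> r"
    and \<eta>: "0 \<le> \<eta>" "\<eta> \<le> 1 / 2" "B * \<eta> \<le> e"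
    and K: "0 < \<alpha> * real K - 1 - e" "B \<le> \<eta> * (\<alpha> * real K - 1 - e)"
    and n1: "\<alpha> * n / 2 \<le> \<alpha> * n - 1 - e"
    and n2: "n \<le> (\<alpha> * n - 1 - e) * (1 / \<alpha> + e / B)"
  shows "(\<Sum>v\<in>V. x v) \<le> B" "real p - 1 / 2 < (\<Sum>v\<in>M. x v)"
proof -
  define X where "X = (\<Sum>v\<in>V. x v)"
  define s where "s = (\<Sum>v\<in>M. x v)"
  define Y where "Y = (\<Sum>v\<in>V - M. x v)"
  have MV: "M \<subseteq> V" "finite M" unfolding M_def using finite_V by auto
  have XsY: "X = s + Y"
    unfolding X_def s_def Y_def using MV finite_V by (simp add: sum.subset_diff)
  have n: "n \<ge> 1" unfolding n_def using x(3) finite_V by (simp add: Suc_le_eq card_gt_0_iff) blast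
  have "real p * (1 - \<alpha>) / \<alpha> \<ge> 0" using \<alpha> by simp
  then have rL: "\<alpha> * n - 1 - e \<le> r" using r by linarith
  have "\<alpha> * n > 0" using \<alpha> n by simp
  then have r0: "\<alpha> * n / 2 \<le> r" "0 < r" using rL n1 by linarith+
  have e0: "e > 0" unfolding e using \<alpha> by simp
  have degn: "(\<Sum>v\<in>V. real (deg E v)) \<le> 2 * real N * n"
  proof -
    have "real (\<Sum>v\<in>V. deg E v) \<le> real (2 * N * card V)" using degs by (rule of_nat_mono)
    then show ?thesis unfolding n_def by simp
  qed
  have tot: "r * X = (\<Sum>v\<in>V. real (deg E v) * x v)"
    unfolding X_def using eig by (rule eigen_total)
  have X0: "X \<ge> 0" unfolding X_def using x(1) by (simp add: sum_nonneg)
  have "\<alpha> * n / 2 * X \<le> r * X" using r0 X0 by (intro mult_right_mono) auto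
  also have "\<dots> \<le> (\<Sum>v\<in>V. real (deg E v))"
    unfolding tot using x(1,2) by (intro sum_mono mult_right_le_one_le) auto
  also note degn
  finally have "n * (\<alpha> * X) \<le> n * (4 * real N)" by (simp add: algebra_simps)
  then have "\<alpha> * X \<le> 4 * real N" using n by simp
  then have XB: "X \<le> B" unfolding B using \<alpha> by (simp add: field_simps)
  then show "(\<Sum>v\<in>V. x v) \<le> B" unfolding X_def .
  have small: "x v \<le> \<eta>" if v: "v \<in> V - M" for v
  proof -
    have "real (deg E v) + real K \<le> n" using v unfolding M_def n_def by auto
    then have "\<alpha> * real (deg E v) + \<alpha> * real K \<le> \<alpha> * n"
      using \<alpha> by (metis distrib_left less_imp_le mult_left_mono)
    then have "(\<alpha> * real K - 1 - e) * x v \<le> (r - \<alpha> * real (deg E v)) * x v"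
      using rL x(1) by (intro mult_right_mono) auto
    also have "\<dots> \<le> X"
      unfolding X_def using v by (intro eigen_entry_bound \<alpha> x(1) eig) auto
    also note XB
    also note K(2)
    finally show ?thesis using K(1) by (simp add: mult.commute)
  qed
  \<comment> \<open>The maximal entry of \<open>x\<close> is \<open>1\<close>, which exceeds \<open>\<eta>\<close>.\<close>
  have uM: "u \<in> M" using small[of u] x(3,4) \<eta> by auto
  have sX: "s \<le> B" using XsY XB x(1) unfolding Y_def by (smt (verit) sum_nonneg)
  have s0: "s \<ge> 0" unfolding s_def using x(1) by (simp add: sum_nonneg)
  \<comment> \<open>The weight \<open>Y\<close> outside \<open>M\<close> is at most \<open>s(1/\<alpha> - 1) + 2e\<close>, where \<open>s\<close> is the weight of \<open>M\<close>.\<close>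
  have "r * Y = (\<Sum>v\<in>V - M. real (deg E v) * x v) + (\<Sum>v\<in>M. real (deg E v) * x v) - r * s"
    using tot XsY MV finite_V by (simp add: sum.subset_diff algebra_simps)
  also have "(\<Sum>v\<in>V - M. real (deg E v) * x v) \<le> (\<Sum>v\<in>V - M. real (deg E v) * \<eta>)"
    using small by (intro sum_mono mult_left_mono) auto
  also have "(\<Sum>v\<in>V - M. real (deg E v) * \<eta>) \<le> 2 * real N * n * \<eta>"
  proof -
    have "(\<Sum>v\<in>V - M. real (deg E v)) \<le> (\<Sum>v\<in>V. real (deg E v))"
      using finite_V by (intro sum_mono2) auto
    then show ?thesis using degn \<eta>(1) by (simp add: mult_right_mono flip: sum_distrib_right)
  qed
  also have "(\<Sum>v\<in>M. real (deg E v) * x v) \<le> (\<Sum>v\<in>M. n * x v)"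
    using deg_less MV(1) x(1) unfolding n_def
    by (intro sum_mono mult_right_mono) (auto intro: less_imp_le)
  also have "(\<Sum>v\<in>M. n * x v) = n * s" unfolding s_def by (simp add: sum_distrib_left)
  finally have rY: "r * Y \<le> 2 * real N * n * \<eta> + n * s - r * s" by linarith
  have "2 * real N * n * \<eta> = (\<alpha> * n / 2) * (B * \<eta>)" unfolding B using \<alpha> by simp
  also have "\<dots> \<le> r * e" using r0 \<eta> B(2) e0 n \<alpha> by (intro mult_mono) auto
  finally have t1: "2 * real N * n * \<eta> \<le> r * e" .
  have "0 \<le> 1 / \<alpha> + e / B" using \<alpha> e0 B(2) by simp
  then have "(\<alpha> * n - 1 - e) * (1 / \<alpha> + e / B) \<le> r * (1 / \<alpha> + e / B)"
    using rL by (rule mult_right_mono[rotated])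
  then have "n \<le> r * (1 / \<alpha> + e / B)" using n2 by linarith
  then have "n * s \<le> r * (1 / \<alpha> + e / B) * s" using s0 by (rule mult_right_mono)
  also have "\<dots> = r * (s / \<alpha> + e * (s / B))" by (simp add: algebra_simps)
  also have "\<dots> \<le> r * (s / \<alpha> + e * 1)"
    using r0 e0 sX B(2) by (intro mult_left_mono add_left_mono) auto
  finally have "r * Y \<le> r * (e + (s / \<alpha> + e) - s)"
    using rY t1 by (simp add: algebra_simps)
  then have "Y \<le> e + (s / \<alpha> + e) - s" using r0(2) by simp
  then have X2: "X \<le> s / \<alpha> + 2 * e" using XsY by linarith
  \<comment> \<open>The eigenvalue equation at the maximal entry, whose vertex has degree at most \<open>n - 1\<close>.\<close>
  have "r = \<alpha> * real (deg E u) + (1 - \<alpha>) * (\<Sum>w\<in>E `` {u}. x w)"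
    using eig[OF x(3)] x(4) unfolding alpha_op_def by simp
  also have "(\<Sum>w\<in>E `` {u}. x w) \<le> (\<Sum>w\<in>V - {u}. x w)"
    using nbhd_sub[of u] E_irrefl[of u] finite_V x(1) by (intro sum_mono2) auto
  also have "(\<Sum>w\<in>V - {u}. x w) = X - 1"
    unfolding X_def using finite_V x(3,4) by (simp add: sum_diff1)
  also have "X - 1 \<le> s / \<alpha> + 2 * e - 1" using X2 by simp
  also have "real (deg E u) \<le> n - 1" using deg_less[OF x(3)] unfolding n_def by linarith
  finally have "r \<le> \<alpha> * (n - 1) + (1 - \<alpha>) * (s / \<alpha> + 2 * e - 1)"
    using \<alpha> by simp
  then have "\<alpha> * n - 1 + real p * (1 - \<alpha>) / \<alpha> - e \<le> \<alpha> * (n - 1) + (1 - \<alpha>) * (s / \<alpha> + 2 * e - 1)"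
    using r by linarith
  moreover have "(1 - \<alpha>) * (2 * e) \<le> 2 * e" using e0 \<alpha> by (intro mult_left_le_one_le) auto
  ultimately have "real p * (1 - \<alpha>) / \<alpha> - (1 - \<alpha>) * (s / \<alpha>) \<le> 3 * e"
    by (simp add: algebra_simps)
  moreover have "(real p - s) * ((1 - \<alpha>) / \<alpha>) = real p * (1 - \<alpha>) / \<alpha> - (1 - \<alpha>) * (s / \<alpha>)"
    using \<alpha> by (simp add: field_simps)
  moreover have "3 * e = (3 / 8) * ((1 - \<alpha>) / \<alpha>)" unfolding e by simp
  ultimately have "(real p - s) * ((1 - \<alpha>) / \<alpha>) \<le> (3 / 8) * ((1 - \<alpha>) / \<alpha>)" by linarith
  moreover have "(1 - \<alpha>) / \<alpha> > 0" using \<alpha> by simp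
  ultimately have "real p - s \<le> 3 / 8" using mult_le_cancel_right_pos by blast
  then show "real p - 1 / 2 < (\<Sum>v\<in>M. x v)" unfolding s_def by linarith
qed

lemma card_common_neighbours:
  assumes "C \<subseteq> V" "\<And>c. c \<in> C \<Longrightarrow> card V \<le> deg E c + K"
  shows "card V \<le> card {v \<in> V. \<forall>c\<in>C. (c, v) \<in> E} + card C * K"
proof -
  let ?T = "{v \<in> V. \<forall>c\<in>C. (c, v) \<in> E}"
  have fC: "finite C" using assms(1) finite_V by (rule finite_subset)
  have "V - ?T \<subseteq> (\<Union>c\<in>C. V - E `` {c})" by auto
  then have "card (V - ?T) \<le> card (\<Union>c\<in>C. V - E `` {c})"
    using fC finite_V by (intro card_mono) auto
  also have "\<dots> \<le> (\<Sum>c\<in>C. card (V - E `` {c}))" using fC by (rule card_UN_le)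
  also have "\<dots> \<le> (\<Sum>c\<in>C. K)"
  proof (rule sum_mono)
    fix c assume "c \<in> C"
    then show "card (V - E `` {c}) \<le> K"
      using assms(2)[of c] nbhd_sub[of c] finite_nbhd[of c] unfolding deg_def
      by (simp add: card_Diff_subset)
  qed
  finally have "card (V - ?T) \<le> card C * K" by simp
  moreover have "card (V - ?T) = card V - card ?T" using finite_V by (intro card_Diff_subset) auto
  ultimately show ?thesis by linarith
qed

end

text \<open>The arcs of the complete split graph on \<open>V\<close> with clique \<open>M\<close>: all arcs that meet \<open>M\<close>.\<close>
definition split_arcs :: "'a set \<Rightarrow> 'a set \<Rightarrow> 'a rel" where
  "split_arcs V M = {(u, v). u \<in> V \<and> v \<in> V \<and> u \<noteq> v \<and> (u \<in> M \<or> v \<in> M)}"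

lemma fin_graph_split: "finite V \<Longrightarrow> fin_graph V (split_arcs V M)"
  by unfold_locales (auto simp: split_arcs_def)

context fin_graph
begin

text \<open>A further vertex with too many neighbours would have many common neighbours with \<open>M\<close>, and together with
  \<open>M\<close> it would provide the \<open>p + 1\<close> centres of the forest.\<close>
lemma degree_outside_heavy:
  assumes I: "finite I" "\<And>i. i \<in> I \<Longrightarrow> 2 \<le> k i" "(\<Sum>i\<in>I. k i div 2) = p + 1"
    and free: "\<not> has_forest E I k V"
    and M: "M \<subseteq> V" "card M = p" "\<And>c. c \<in> M \<Longrightarrow> card V \<le> deg E c + K"
    and a: "a \<in> V - M"
  shows "deg E a \<le> (\<Sum>i\<in>I. k i) + p * K"
proof (rule ccontr)
  assume large: "\<not> deg E a \<le> (\<Sum>i\<in>I. k i) + p * K"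
  define T where "T = {v \<in> V. \<forall>c\<in>M. (c, v) \<in> E}"
  have fM: "finite M" using M(1) finite_V by (rule finite_subset)
  have "card V \<le> card T + p * K" unfolding T_def using card_common_neighbours[OF M(1,3)] M(2) by simp
  moreover have "card (E `` {a} \<union> T) \<le> card V"
    using nbhd_sub finite_V by (intro card_mono) (auto simp: T_def)
  moreover have "card (E `` {a}) + card T = card (E `` {a} \<union> T) + card (E `` {a} \<inter> T)"
    using finite_nbhd finite_V by (intro card_Un_Int) (auto simp: T_def)
  ultimately have "(\<Sum>i\<in>I. k i) \<le> card (E `` {a} \<inter> T)" using large unfolding deg_def by linarith
  then have "has_forest E I k V"
    using I M(1,2) a fM by (intro forest_of_common_neighbours[of "insert a M" "E `` {a} \<inter> T"]) (auto simp: T_def)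
  then show False using free by simp
qed

lemma card_heavy_le:
  assumes I: "finite I" "\<And>i. i \<in> I \<Longrightarrow> 2 \<le> k i" "(\<Sum>i\<in>I. k i div 2) = p + 1"
    and free: "\<not> has_forest E I k V"
    and n: "(p + 1) * K + (\<Sum>i\<in>I. k i) \<le> card V"
  shows "card {v \<in> V. card V \<le> deg E v + K} \<le> p"
proof (rule ccontr)
  assume "\<not> card {v \<in> V. card V \<le> deg E v + K} \<le> p"
  then obtain C where C: "C \<subseteq> {v \<in> V. card V \<le> deg E v + K}" "card C = p + 1"
    using obtain_subset_with_card_n[of "p + 1"] by (metis Suc_eq_plus1 not_less_eq_eq)
  define T where "T = {v \<in> V. \<forall>c\<in>C. (c, v) \<in> E}"
  have "card V \<le> card T + (p + 1) * K"
    unfolding T_def using card_common_neighbours[of C K] C by (metis (mono_tags, lifting) mem_Collect_eq subset_eq)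
  then have "(\<Sum>i\<in>I. k i) \<le> card T" using n by linarith
  then have "has_forest E I k V"
    using I C by (intro forest_of_common_neighbours[of C T]) (auto simp: T_def)
  then show False using free by simp
qed

text \<open>The eigenvector of the graph is a test vector for the complete split graph: a missing arc at \<open>M\<close>
  contributes at least \<open>\<alpha>/4\<close>, while the arcs outside \<open>M\<close>, at most \<open>D n\<close> in number, contribute at most
  \<open>c\<^sup>2\<close> each.\<close>
lemma radius_less_split:
  fixes D :: nat
  assumes \<alpha>: "0 < \<alpha>" "\<alpha> < 1"
    and x: "\<And>v. 0 \<le> x v" "\<And>v. v \<in> V \<Longrightarrow> alpha_op \<alpha> E x v = r * x v"
    and M: "M \<subseteq> V" "\<And>v. v \<in> M \<Longrightarrow> 1 / 2 \<le> x v"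
    and light: "\<And>v. v \<in> V - M \<Longrightarrow> x v \<le> c" "\<And>v. v \<in> V - M \<Longrightarrow> deg E v \<le> D"
    and small: "real D * real (card V) * c\<^sup>2 < \<alpha> / 4"
    and s: "is_alpha_radius \<alpha> V (split_arcs V M) s"
    and nd: "\<not> dominating V E M"
  shows "r < s"
proof -
  let ?H = "split_arcs V M"
  interpret H: fin_graph V ?H by (rule fin_graph_split[OF finite_V])
  define q where "q = (\<lambda>(v, w). \<alpha> * (x v)\<^sup>2 + (1 - \<alpha>) * (x v * x w))"
  have q0: "0 \<le> q a" for a unfolding q_def using x(1) \<alpha> by (cases a) simp
  obtain u v where uv: "u \<in> M" "v \<in> V" "u \<noteq> v" "(u, v) \<notin> E"
    using nd M(1) unfolding dominating_def by blast
  then have uvH: "(u, v) \<in> ?H - E" using M(1) by (auto simp: split_arcs_def)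
  have "(1 / 2)\<^sup>2 \<le> (x u)\<^sup>2" using M(2)[OF uv(1)] by (intro power_mono) auto
  then have "\<alpha> * (1 / 4) \<le> \<alpha> * (x u)\<^sup>2" using \<alpha> by (intro mult_left_mono) (auto simp: power2_eq_square)
  also have "\<dots> \<le> q (u, v)" unfolding q_def using \<alpha> x(1) by simp
  also have "\<dots> \<le> sum q (?H - E)"
    using uvH H.finite_E q0 by (intro member_le_sum) auto
  finally have gain: "\<alpha> / 4 \<le> sum q (?H - E)" by simp
  have EH: "E - ?H \<subseteq> (SIGMA a:V - M. E `` {a})" "E - ?H \<subseteq> (V - M) \<times> (V - M)"
    using E_sub E_irrefl by (auto simp: split_arcs_def)
  have "sum q (E - ?H) \<le> (\<Sum>a\<in>E - ?H. c\<^sup>2)"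
  proof (rule sum_mono)
    fix a assume "a \<in> E - ?H"
    then obtain v w where a: "a = (v, w)" "v \<in> V - M" "w \<in> V - M" using EH(2) by blast
    have "(x v)\<^sup>2 \<le> c\<^sup>2" using light(1)[OF a(2)] x(1) by (intro power_mono)
    moreover have "x v * x w \<le> c\<^sup>2"
      unfolding power2_eq_square using light(1)[OF a(2)] light(1)[OF a(3)] x(1)[of v] x(1)[of w]
      by (intro mult_mono) auto
    ultimately have "q a \<le> \<alpha> * c\<^sup>2 + (1 - \<alpha>) * c\<^sup>2"
      unfolding q_def a(1) using \<alpha> by (auto intro!: add_mono mult_left_mono)
    then show "q a \<le> c\<^sup>2" by (simp add: algebra_simps)
  qed
  also have "\<dots> = real (card (E - ?H)) * c\<^sup>2" by simp
  also have "\<dots> \<le> real (D * card V) * c\<^sup>2"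
  proof (intro mult_right_mono of_nat_mono)
    have "card (E - ?H) \<le> card (SIGMA a:V - M. E `` {a})"
      using EH(1) finite_V finite_nbhd by (intro card_mono finite_SigmaI) auto
    also have "\<dots> = (\<Sum>a\<in>V - M. deg E a)" using finite_V finite_nbhd by (simp add: deg_def)
    also have "\<dots> \<le> (\<Sum>a\<in>V - M. D)" using light(2) by (intro sum_mono)
    also have "\<dots> \<le> D * card V" using finite_V by (simp add: card_mono)
    finally show "card (E - ?H) \<le> D * card V" .
  qed simp
  finally have "sum q (E - ?H) < \<alpha> / 4" using small by simp
  moreover have "sum q ?H = sum q (?H \<inter> E) + sum q (?H - E)" "sum q E = sum q (E \<inter> ?H) + sum q (E - ?H)"
    using H.finite_E finite_E by (simp_all add: sum.Int_Diff)
  ultimately have "sum q E < sum q ?H" using gain by (simp add: Int_commute)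
  moreover have "sum q ?H = alpha_form \<alpha> ?H x" "sum q E = alpha_form \<alpha> E x"
    unfolding q_def alpha_form_def by simp_all
  moreover have "alpha_form \<alpha> E x = r * (\<Sum>v\<in>V. (x v)\<^sup>2)"
    unfolding form_eq using x(2) by (simp add: sum_distrib_left power2_eq_square algebra_simps)
  moreover have "alpha_form \<alpha> ?H x \<le> s * (\<Sum>v\<in>V. (x v)\<^sup>2)" using s unfolding is_alpha_radius_def by blast
  ultimately have "r * (\<Sum>v\<in>V. (x v)\<^sup>2) < s * (\<Sum>v\<in>V. (x v)\<^sup>2)" by linarith
  then show ?thesis by (meson mult_right_less_imp_less sum_nonneg zero_le_power2)
qed

text \<open>The hypotheses \<open>n1\<close> to \<open>n5\<close> say that the order is large compared with the constants.\<close>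
lemma dominating_of_large_radius:
  fixes \<alpha> r e \<eta> B :: real and p K :: nat and I :: "'i set" and k :: "'i \<Rightarrow> nat"
  defines "n \<equiv> real (card V)" and "N \<equiv> \<Sum>i\<in>I. k i"
  assumes \<alpha>: "0 < \<alpha>" "\<alpha> < 1"
    and I: "finite I" "\<And>i. i \<in> I \<Longrightarrow> 2 \<le> k i" "(\<Sum>i\<in>I. k i div 2) = p + 1"
    and free: "\<not> has_forest E I k V"
    and rad: "is_alpha_radius \<alpha> V E r"
    and split: "\<And>M. M \<subseteq> V \<Longrightarrow> card M = p \<Longrightarrow> \<exists>s\<le>r. is_alpha_radius \<alpha> V (split_arcs V M) s"
    and e: "e = (1 - \<alpha>) / (8 * \<alpha>)" and B: "B = 4 * real N / \<alpha>" "0 < B"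
    and r: "\<alpha> * n - 1 + real p * (1 - \<alpha>) / \<alpha> - e \<le> r"
    and \<eta>: "0 \<le> \<eta>" "\<eta> \<le> 1 / 2" "B * \<eta> \<le> e"
    and K: "0 < \<alpha> * real K - 1 - e" "B \<le> \<eta> * (\<alpha> * real K - 1 - e)"
    and n1: "\<alpha> * n / 2 \<le> \<alpha> * n - 1 - e"
    and n2: "n \<le> (\<alpha> * n - 1 - e) * (1 / \<alpha> + e / B)"
    and n3: "(p + 1) * K + N \<le> card V"
    and n4: "\<alpha> * n / 4 \<le> \<alpha> * n - 1 - e - \<alpha> * real (N + p * K)"
    and n5: "real (N + p * K) * n * (4 * B / (\<alpha> * n))\<^sup>2 < \<alpha> / 4"
  shows "\<exists>M. card M = p \<and> dominating V E M"
proof -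
  obtain x u where x: "\<And>v. 0 \<le> x v" "\<And>v. v \<in> V \<Longrightarrow> x v \<le> 1" "u \<in> V" "x u = 1"
    and eig: "\<And>v. v \<in> V \<Longrightarrow> alpha_op \<alpha> E x v = r * x v"
    using normalized_eigenvector[OF rad] by blast
  define M where "M = {v \<in> V. card V \<le> deg E v + K}"
  have MV: "M \<subseteq> V" "finite M" unfolding M_def using finite_V by auto
  have degs: "(\<Sum>v\<in>V. deg E v) \<le> 2 * N * card V"
    unfolding N_def using free I(1) by (rule degree_sum_le)
  note weight = weight_of_large_degrees[OF \<alpha> x eig degs e B r[unfolded n_def] \<eta> K n1[unfolded n_def] n2[unfolded n_def],
      folded M_def]
  have "(\<Sum>v\<in>M. x v) \<le> (\<Sum>v\<in>M. 1)" using x(2) MV(1) by (intro sum_mono) auto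
  then have "real p - 1 / 2 < real (card M)" using weight(2) by simp
  moreover have "card M \<le> p"
    unfolding M_def using I free n3 unfolding N_def by (intro card_heavy_le) auto
  ultimately have cM: "card M = p" by linarith
  have heavy: "1 / 2 \<le> x v" if v: "v \<in> M" for v
  proof -
    have "(\<Sum>w\<in>M - {v}. x w) \<le> (\<Sum>w\<in>M - {v}. 1)" using x(2) MV(1) by (intro sum_mono) auto
    also have "\<dots> = real p - 1"
      using card_Suc_Diff1[OF MV(2) v] cM by simp
    finally show ?thesis using weight(2) MV(2) v by (simp add: sum.remove[of M v])
  qed
  have low: "deg E a \<le> N + p * K" if "a \<in> V - M" for a
    unfolding N_def using I free MV(1) cM _ that by (rule degree_outside_heavy) (auto simp: M_def)
  have V1: "card V \<ge> 1" using x(3) finite_V by (metis One_nat_def Suc_leI card_gt_0_iff empty_iff)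
  then have an: "0 < \<alpha> * n" using \<alpha> unfolding n_def by simp
  have "real p * (1 - \<alpha>) / \<alpha> \<ge> 0" using \<alpha> by simp
  then have rL: "\<alpha> * n - 1 - e \<le> r" using r by linarith
  have light: "x a \<le> 4 * B / (\<alpha> * n)" if a: "a \<in> V - M" for a
  proof -
    have "real (deg E a) \<le> real (N + p * K)" using low[OF a] by (rule of_nat_mono)
    then have "\<alpha> * real (deg E a) \<le> \<alpha> * real (N + p * K)" using \<alpha>(1) by (rule mult_left_mono[OF _ less_imp_le])
    then have "\<alpha> * n / 4 * x a \<le> (r - \<alpha> * real (deg E a)) * x a"
      using n4 rL x(1) by (intro mult_right_mono) auto
    also have "\<dots> \<le> (\<Sum>v\<in>V. x v)" using a by (intro eigen_entry_bound \<alpha> x(1) eig) auto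
    also note weight(1)
    finally show ?thesis using an by (simp add: field_simps)
  qed
  obtain s where s: "s \<le> r" "is_alpha_radius \<alpha> V (split_arcs V M) s" using split[OF MV(1) cM] by blast
  have "dominating V E M"
  proof (rule ccontr)
    assume "\<not> dominating V E M"
    then have "r < s"
      using radius_less_split[OF \<alpha> x(1) eig MV(1) heavy light[unfolded n_def] low n5[unfolded n_def] s(2)]
      by blast
    then show False using s(1) by simp
  qed
  then show ?thesis using cM by blast
qed

end


lemma eventually_real_gt: "eventually (\<lambda>n. c < real n) sequentially"
  using filterlim_real_sequentially by (simp add: filterlim_at_top_dense)

text \<open>A graph of large order without the forest whose radius is at least that of every complete split graph
  with a clique of order \<open>p\<close> has a dominating set of order \<open>p\<close>. The lower bound on the radius is the
  asymptotic value of the radius of the complete split graph up to a constant slack.\<close>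
lemma eventually_dominating:
  fixes \<alpha> :: real and p :: nat and I :: "'i set" and k :: "'i \<Rightarrow> nat"
  assumes \<alpha>: "0 < \<alpha>" "\<alpha> < 1"
    and I: "finite I" "\<forall>i\<in>I. 2 \<le> k i" "(\<Sum>i\<in>I. k i div 2) = p + 1"
  shows "eventually (\<lambda>n. \<forall>(V :: 'a set) E r. fin_graph V E \<longrightarrow> card V = n \<longrightarrow> \<not> has_forest E I k V \<longrightarrow>
      is_alpha_radius \<alpha> V E r \<longrightarrow>
      (\<forall>M. M \<subseteq> V \<longrightarrow> card M = p \<longrightarrow> (\<exists>s\<le>r. is_alpha_radius \<alpha> V (split_arcs V M) s)) \<longrightarrow>
      \<alpha> * real n - 1 + real p * (1 - \<alpha>) / \<alpha> - (1 - \<alpha>) / (8 * \<alpha>) \<le> r \<longrightarrow>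
      (\<exists>M. card M = p \<and> dominating V E M)) sequentially"
proof -
  define N where "N = (\<Sum>i\<in>I. k i)"
  define e where "e = (1 - \<alpha>) / (8 * \<alpha>)"
  define B where "B = 4 * real N / \<alpha>"
  define \<eta> where "\<eta> = min (1 / 2) (e / B)"
  have "(\<Sum>i\<in>I. k i div 2) \<le> N" unfolding N_def by (intro sum_mono) simp
  then have "N > 0" using I(3) by simp
  then have B: "0 < B" unfolding B_def using \<alpha> by simp
  have e: "0 < e" unfolding e_def using \<alpha> by simp
  have \<eta>: "0 < \<eta>" "\<eta> \<le> 1 / 2" "B * \<eta> \<le> e"
    unfolding \<eta>_def using B e by (auto simp: min_def field_simps)
  obtain K :: nat where K: "(B / \<eta> + 1 + e) / \<alpha> < real K" using reals_Archimedean2 by blast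
  then have K': "B / \<eta> < \<alpha> * real K - 1 - e" using \<alpha> by (simp add: field_simps)
  then have K1: "0 < \<alpha> * real K - 1 - e" using B \<eta> by (smt (verit) divide_pos_pos)
  have K2: "B \<le> \<eta> * (\<alpha> * real K - 1 - e)" using K' \<eta>(1) by (simp add: field_simps)
  define D where "D = N + p * K"
  have E: "eventually (\<lambda>n. 2 * (1 + e) / \<alpha> < real n) sequentially"
    "eventually (\<lambda>n. (1 + e) * (1 / \<alpha> + e / B) * B / (\<alpha> * e) < real n) sequentially"
    "eventually (\<lambda>n. real ((p + 1) * K + N) < real n) sequentially"
    "eventually (\<lambda>n. 4 * (1 + e + \<alpha> * real D) / (3 * \<alpha>) < real n) sequentially"
    "eventually (\<lambda>n. 64 * real D * B\<^sup>2 / \<alpha> ^ 3 < real n) sequentially"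
    "eventually (\<lambda>n. 0 < real n) sequentially"
    by (rule eventually_real_gt)+
  then show ?thesis
  proof eventually_elim
    case (elim n)
    have n1: "\<alpha> * real n / 2 \<le> \<alpha> * real n - 1 - e" using elim(1) \<alpha> by (simp add: field_simps)
    have "(1 + e) * (1 / \<alpha> + e / B) < real n * (\<alpha> * e / B)"
      using elim(2) \<alpha> e B by (simp add: pos_divide_less_eq mult.assoc) (simp add: field_simps)
    moreover have "(\<alpha> * real n - 1 - e) * (1 / \<alpha> + e / B)
        = real n + real n * (\<alpha> * e / B) - (1 + e) * (1 / \<alpha> + e / B)"
      using \<alpha> by (simp add: algebra_simps)
    ultimately have n2: "real n \<le> (\<alpha> * real n - 1 - e) * (1 / \<alpha> + e / B)" by linarith
    have n3: "(p + 1) * K + N \<le> n" using elim(3) by linarith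
    have n4: "\<alpha> * real n / 4 \<le> \<alpha> * real n - 1 - e - \<alpha> * real D"
      using elim(4) \<alpha> by (simp add: field_simps)
    have n5: "real D * real n * (4 * B / (\<alpha> * real n))\<^sup>2 < \<alpha> / 4"
    proof -
      have "real D * real n * (4 * B / (\<alpha> * real n))\<^sup>2 = 16 * real D * B\<^sup>2 / (\<alpha>\<^sup>2 * real n)"
        using elim(6) \<alpha> by (simp add: field_simps power2_eq_square)
      also have "\<dots> < \<alpha> / 4"
        using elim(5,6) \<alpha> by (simp add: field_simps power2_eq_square power3_eq_cube)
      finally show ?thesis .
    qed
    show ?case
    proof (intro allI impI)
      fix V :: "'a set" and E r
      assume G: "fin_graph V E" "card V = n" "\<not> has_forest E I k V" "is_alpha_radius \<alpha> V E r"
        "\<forall>M. M \<subseteq> V \<longrightarrow> card M = p \<longrightarrow> (\<exists>s\<le>r. is_alpha_radius \<alpha> V (split_arcs V M) s)"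
        "\<alpha> * real n - 1 + real p * (1 - \<alpha>) / \<alpha> - (1 - \<alpha>) / (8 * \<alpha>) \<le> r"
      interpret fin_graph V E by fact
      show "\<exists>M. card M = p \<and> dominating V E M"
      proof (rule dominating_of_large_radius[OF \<alpha> I(1) _ I(3) G(3,4)])
        show "2 \<le> k i" if "i \<in> I" for i using that I(2) by blast
        show "e = (1 - \<alpha>) / (8 * \<alpha>)" by (rule e_def)
        show "B = 4 * real (\<Sum>i\<in>I. k i) / \<alpha>" unfolding B_def N_def ..
        show "0 \<le> \<eta>" using \<eta> by simp
      qed (use G(2,5,6) B \<eta> K1 K2 n1 n2 n3 n4[unfolded D_def] n5[unfolded D_def] in \<open>simp_all add: e_def[symmetric] N_def[symmetric] del: of_nat_sum of_nat_add of_nat_mult\<close>)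
    qed
  qed
qed

section \<open>Joins of a clique with a matching\<close>

text \<open>The vertices outside \<open>M\<close> that have a neighbour outside \<open>M\<close>.\<close>
definition inner_vertices :: "'a set \<Rightarrow> 'a rel \<Rightarrow> 'a set \<Rightarrow> 'a set" where
  "inner_vertices V E M = {v \<in> V - M. \<exists>w\<in>V - M. (v, w) \<in> E}"

text \<open>The graph is the join of a clique on \<open>M\<close> of order \<open>p\<close> with a graph whose edges form a matching that
  covers exactly \<open>m\<close> vertices. All three extremal graphs have this form.\<close>
definition matched_join :: "'a set \<Rightarrow> 'a rel \<Rightarrow> nat \<Rightarrow> nat \<Rightarrow> 'a set \<Rightarrow> bool" where
  "matched_join V E p m M \<longleftrightarrow> dominating V E M \<and> card M = p \<and> card (inner_vertices V E M) = m \<and>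
     (\<forall>u\<in>V - M. \<forall>v\<in>V - M. \<forall>w\<in>V - M. (u, v) \<in> E \<longrightarrow> (u, w) \<in> E \<longrightarrow> v = w)"

text \<open>The characteristic polynomial of the quotient matrix of such a join with respect to the three classes
  of clique vertices, isolated vertices and matched vertices.\<close>
definition join_poly :: "real \<Rightarrow> real \<Rightarrow> real \<Rightarrow> real \<Rightarrow> real \<Rightarrow> real" where
  "join_poly \<alpha> n p m x =
     (x - \<alpha> * (n - 1) - (1 - \<alpha>) * (p - 1)) * (x - \<alpha> * p) * (x - \<alpha> * p - 1)
     - (1 - \<alpha>)\<^sup>2 * p * ((n - p) * (x - \<alpha> * p - 1) + m)"

context fin_graph
begin

text \<open>For \<open>s > \<alpha>p + 1\<close> the eigenvector of the quotient matrix is positive: it is \<open>ab\<close> on the clique, \<open>ca\<close> on the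
  matched vertices and \<open>cb\<close> elsewhere, with \<open>a\<close>, \<open>b\<close> and \<open>c\<close> as in the proof.\<close>
lemma radius_of_matched_join:
  assumes \<alpha>: "0 < \<alpha>" "\<alpha> < 1" and p: "1 \<le> p"
    and M: "matched_join V E p m M"
    and s: "\<alpha> * real p + 1 < s" "join_poly \<alpha> (real (card V)) (real p) (real m) s = 0"
    and r: "is_alpha_radius \<alpha> V E r"
  shows "r = s"
proof -
  define J where "J = inner_vertices V E M"
  have dom: "M \<subseteq> V" "\<And>u v. u \<in> M \<Longrightarrow> v \<in> V \<Longrightarrow> u \<noteq> v \<Longrightarrow> (u, v) \<in> E"
    and cM: "card M = p" and cJ: "card J = m"
    and uni: "\<And>u v w. u \<in> V - M \<Longrightarrow> v \<in> V - M \<Longrightarrow> w \<in> V - M \<Longrightarrow> (u, v) \<in> E \<Longrightarrow> (u, w) \<in> E \<Longrightarrow> v = w"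
    using M unfolding matched_join_def dominating_def J_def by blast+
  have J: "J \<subseteq> V - M" unfolding J_def inner_vertices_def by blast
  have fin: "finite M" "finite J" "finite (V - M - J)"
    using finite_V dom(1) J by (auto intro: finite_subset)
  define a where "a = s - \<alpha> * real p"
  define b where "b = s - \<alpha> * real p - 1"
  define c where "c = (1 - \<alpha>) * real p"
  have ab: "0 < a" "0 < b" "a = b + 1" "0 < c" unfolding a_def b_def c_def using s \<alpha> p by auto
  define y where "y = (\<lambda>v. if v \<in> M then a * b else if v \<in> J then c * a else c * b)"
  have sM: "(\<Sum>w\<in>M. y w) = real p * (a * b)" unfolding y_def using cM by simp
  have sJ: "(\<Sum>w\<in>J. y w) = real m * (c * a)"
  proof -
    have "(\<Sum>w\<in>J. y w) = (\<Sum>w\<in>J. c * a)" unfolding y_def using J by (intro sum.cong) auto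
    then show ?thesis using cJ by simp
  qed
  have split: "(\<Sum>w\<in>V. g w) = (\<Sum>w\<in>M. g w) + (\<Sum>w\<in>J. g w) + (\<Sum>w\<in>V - M - J. g w)"
    for g :: "'a \<Rightarrow> real"
  proof -
    have "(\<Sum>w\<in>V. g w) = (\<Sum>w\<in>V - M. g w) + (\<Sum>w\<in>M. g w)"
      using dom(1) finite_V by (rule sum.subset_diff)
    also have "(\<Sum>w\<in>V - M. g w) = (\<Sum>w\<in>V - M - J. g w) + (\<Sum>w\<in>J. g w)"
      using J finite_V by (intro sum.subset_diff) auto
    finally show ?thesis by simp
  qed
  have cR: "real (card (V - M - J)) = real (card V) - real p - real m"
    using split[of "\<lambda>_. 1"] cM cJ by simp
  have "(\<Sum>w\<in>V - M - J. y w) = (\<Sum>w\<in>V - M - J. c * b)" unfolding y_def by (intro sum.cong) auto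
  then have sR: "(\<Sum>w\<in>V - M - J. y w) = (real (card V) - real p - real m) * (c * b)"
    using cR by simp
  have sV: "(\<Sum>w\<in>V. y w) = real p * (a * b) + real m * (c * a)
      + (real (card V) - real p - real m) * (c * b)"
    unfolding split[of y] sM sJ sR by simp
  have eig: "alpha_op \<alpha> E y v = s * y v" if v: "v \<in> V" for v
  proof (cases "v \<in> M")
    case True
    then have N: "E `` {v} = V - {v}" using dom(2)[OF True] nbhd_sub[of v] E_irrefl by blast
    have d: "real (deg E v) = real (card V) - 1"
      unfolding deg_def N using v finite_V card_Suc_Diff1[OF finite_V v] by linarith
    have yv: "y v = a * b" using True by (simp add: y_def)
    have S: "(\<Sum>w\<in>E `` {v}. y w) = (\<Sum>w\<in>V. y w) - a * b"
      unfolding N yv[symmetric] using v finite_V by (simp add: sum_diff1)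
    then have "alpha_op \<alpha> E y v - s * y v = - ((s - \<alpha> * (real (card V) - 1) - (1 - \<alpha>) * (real p - 1)) * (a * b)
        - (1 - \<alpha>) * (real m * (c * a) + (real (card V) - real p - real m) * (c * b)))"
      unfolding alpha_op_def d S sV yv by (simp add: algebra_simps)
    also have "\<dots> = - join_poly \<alpha> (real (card V)) (real p) (real m) s"
      unfolding join_poly_def a_def b_def c_def by (simp add: algebra_simps power2_eq_square)
    finally show ?thesis using s(2) by simp
  next
    case False
    then have MN: "M \<subseteq> E `` {v}" using dom(2) v E_sym by auto
    show ?thesis
    proof (cases "v \<in> J")
      case True
      then obtain w where w: "w \<in> V - M" "(v, w) \<in> E" unfolding J_def inner_vertices_def by blast
      then have wJ: "w \<in> J" using True J E_sym unfolding J_def inner_vertices_def by blast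
      have N: "E `` {v} = insert w M"
        using MN w uni[of v w] nbhd_sub[of v] v False by blast
      have d: "real (deg E v) = real p + 1" unfolding deg_def N using fin(1) w(1) cM by simp
      have yv: "y v = c * a" using True False by (simp add: y_def)
      have S: "(\<Sum>u\<in>E `` {v}. y u) = c * a + real p * (a * b)"
        unfolding N using fin(1) w(1) sM wJ by (simp add: y_def)
      have "alpha_op \<alpha> E y v = c * a * (\<alpha> * (real p + 1) + (1 - \<alpha>)) + c * (a * b)"
        unfolding alpha_op_def d S yv by (simp add: c_def algebra_simps)
      also have "\<dots> = s * y v" unfolding yv a_def b_def by (simp add: algebra_simps)
      finally show ?thesis .
    next
      case nJ: False
      then have N: "E `` {v} = M" using MN nbhd_sub[of v] v False unfolding J_def inner_vertices_def by blast
      have yv: "y v = c * b" using nJ False by (simp add: y_def)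
      have "alpha_op \<alpha> E y v = \<alpha> * real p * (c * b) + c * (a * b)"
        unfolding alpha_op_def deg_def N sM cM yv by (simp add: c_def)
      also have "\<dots> = s * y v" unfolding yv a_def by (simp add: algebra_simps)
      finally show ?thesis .
    qed
  qed
  show ?thesis
    using r eig by (rule radius_of_positive_eigenvector) (use ab in \<open>auto simp: y_def\<close>)
qed

end

text \<open>Beyond \<open>\<alpha>p + 1\<close> the equation can be written as \<open>x - c = F m x\<close>, where \<open>F\<close> increases with \<open>m\<close> and
  decreases with \<open>x\<close>. For \<open>m = m'\<close> this gives uniqueness of the root.\<close>
lemma join_poly_root_mono:
  assumes \<alpha>: "0 < \<alpha>" "\<alpha> < 1" and p: "1 \<le> p" "p \<le> n"
    and s: "\<alpha> * p + 1 < s" "join_poly \<alpha> n p m s = 0"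
    and s': "\<alpha> * p + 1 < s'" "join_poly \<alpha> n p m' s' = 0"
    and m: "0 \<le> m" "m \<le> m'"
  shows "s \<le> s'"
proof (rule ccontr)
  assume less: "\<not> s \<le> s'"
  define c where "c = \<alpha> * (n - 1) + (1 - \<alpha>) * (p - 1)"
  define d where "d = (1 - \<alpha>)\<^sup>2 * p"
  define F where "F = (\<lambda>m x. d * ((n - p) / (x - \<alpha> * p) + m / ((x - \<alpha> * p) * (x - \<alpha> * p - 1))))"
  have d: "0 \<le> d" unfolding d_def using p by simp
  have root: "x - c = F m x" if "\<alpha> * p + 1 < x" "join_poly \<alpha> n p m x = 0" for m x
  proof -
    define a b where "a = x - \<alpha> * p" and "b = x - \<alpha> * p - 1"
    have ab: "0 < a" "0 < b" using that(1) unfolding a_def b_def by auto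
    have "(x - c) * (a * b) = d * ((n - p) * b + m)"
      using that(2) unfolding join_poly_def a_def b_def c_def d_def by (simp add: algebra_simps)
    then have "x - c = d * ((n - p) * b + m) / (a * b)"
      using ab by (simp add: nonzero_eq_divide_eq)
    also have "\<dots> = d * (((n - p) * b + m) / (a * b))" by simp
    also have "((n - p) * b + m) / (a * b) = (n - p) / a + m / (a * b)"
      using ab by (simp add: add_divide_distrib)
    finally show ?thesis unfolding F_def a_def b_def .
  qed
  have "F m s \<le> F m' s"
    unfolding F_def using d s(1) m by (intro mult_left_mono add_left_mono divide_right_mono) auto
  also have "\<dots> \<le> F m' s'"
    unfolding F_def using d s(1) s'(1) m p less
    by (intro mult_left_mono add_mono divide_left_mono mult_mono mult_pos_pos) auto
  finally have "s - c \<le> s' - c" using root[OF s] root[OF s'] by simp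
  then show False using less by simp
qed

lemma join_poly_root_inj:
  assumes "\<alpha> < 1" "0 < p" "join_poly \<alpha> n p m s = 0" "join_poly \<alpha> n p m' s = 0"
  shows "m = m'"
proof -
  have "(1 - \<alpha>)\<^sup>2 * p * (m - m') = join_poly \<alpha> n p m' s - join_poly \<alpha> n p m s"
    unfolding join_poly_def by (simp add: algebra_simps)
  then show ?thesis using assms by simp
qed

text \<open>The larger root of the quadratic factor of \<open>join_poly\<close> for \<open>m = 0\<close>. Once it exceeds \<open>\<alpha>p + 1\<close> it is the
  radius of the complete split graph.\<close>
definition split_radius :: "real \<Rightarrow> real \<Rightarrow> real \<Rightarrow> real" where
  "split_radius \<alpha> n p = (\<alpha> * n + p - 1
     + sqrt ((\<alpha> * n + p - 1) ^ 2 - 4 * p * (2 * \<alpha> - 1) * n - 4 * p * (p - (p + 1) * \<alpha>))) / 2"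

text \<open>A point where a monic quadratic is negative lies below its larger root, and in particular the
  discriminant is nonnegative.\<close>
lemma quadratic_root_gt:
  fixes x b c :: real
  assumes "x\<^sup>2 - b * x + c < 0"
  shows "x < (b + sqrt (b\<^sup>2 - 4 * c)) / 2"
    and "((b + sqrt (b\<^sup>2 - 4 * c)) / 2)\<^sup>2 - b * ((b + sqrt (b\<^sup>2 - 4 * c)) / 2) + c = 0"
proof -
  have sq: "(2 * x - b)\<^sup>2 < b\<^sup>2 - 4 * c"
    using assms by (simp add: power2_eq_square algebra_simps)
  then have "2 * x - b < sqrt (b\<^sup>2 - 4 * c)" by (rule real_less_rsqrt)
  then show "x < (b + sqrt (b\<^sup>2 - 4 * c)) / 2" by simp
  have "0 \<le> b\<^sup>2 - 4 * c" using sq by (smt (verit) zero_le_power2)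
  then have "(sqrt (b\<^sup>2 - 4 * c))\<^sup>2 = b\<^sup>2 - 4 * c" by simp
  then show "((b + sqrt (b\<^sup>2 - 4 * c)) / 2)\<^sup>2 - b * ((b + sqrt (b\<^sup>2 - 4 * c)) / 2) + c = 0"
    by (simp add: power2_eq_square field_simps)
qed

lemma split_radius_gt:
  assumes "x\<^sup>2 - (\<alpha> * n + p - 1) * x + p * ((2 * \<alpha> - 1) * n + (p - (p + 1) * \<alpha>)) < 0"
  shows "x < split_radius \<alpha> n p"
    and "join_poly \<alpha> n p 0 (split_radius \<alpha> n p) = 0"
proof -
  have eq: "split_radius \<alpha> n p = ((\<alpha> * n + p - 1) + sqrt ((\<alpha> * n + p - 1)\<^sup>2
      - 4 * (p * ((2 * \<alpha> - 1) * n + (p - (p + 1) * \<alpha>))))) / 2"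
    unfolding split_radius_def by (simp add: algebra_simps)
  show "x < split_radius \<alpha> n p" unfolding eq using assms by (rule quadratic_root_gt)
  have "(split_radius \<alpha> n p)\<^sup>2 - (\<alpha> * n + p - 1) * split_radius \<alpha> n p
      + p * ((2 * \<alpha> - 1) * n + (p - (p + 1) * \<alpha>)) = 0"
    unfolding eq using assms by (rule quadratic_root_gt)
  moreover have "join_poly \<alpha> n p 0 x = (x - \<alpha> * p - 1) *
     (x\<^sup>2 - (\<alpha> * n + p - 1) * x + p * ((2 * \<alpha> - 1) * n + (p - (p + 1) * \<alpha>)))" for x
    unfolding join_poly_def by (simp add: algebra_simps power2_eq_square)
  ultimately show "join_poly \<alpha> n p 0 (split_radius \<alpha> n p) = 0" by simp
qed

text \<open>At \<open>\<alpha>n - 1 + p(1 - \<alpha>)/\<alpha> - e\<close> the quadratic factor equals \<open>-\<alpha>en + O(1)\<close>, hence is negative for large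
  \<open>n\<close>.\<close>
lemma eventually_split_radius_gt:
  fixes \<alpha> p e :: real
  assumes \<alpha>: "0 < \<alpha>" "\<alpha> < 1" and p: "1 \<le> p" and e: "0 < e"
  shows "eventually (\<lambda>n. \<alpha> * p + 1 < split_radius \<alpha> (real n) p \<and>
     join_poly \<alpha> (real n) p 0 (split_radius \<alpha> (real n) p) = 0 \<and>
     \<alpha> * real n - 1 + p * (1 - \<alpha>) / \<alpha> - e < split_radius \<alpha> (real n) p) sequentially"
proof -
  define q where "q = (\<lambda>n x. x\<^sup>2 - (\<alpha> * n + p - 1) * x + p * ((2 * \<alpha> - 1) * n + (p - (p + 1) * \<alpha>)))"
  define d where "d = - 1 + p * (1 - \<alpha>) / \<alpha> - e"
  have "q n (\<alpha> * n + d) = - (\<alpha> * e) * n + (d * (d + 1 - p) + p * (p - (p + 1) * \<alpha>))" for n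
  proof -
    have "\<alpha> * d = - \<alpha> + p * (1 - \<alpha>) - \<alpha> * e" unfolding d_def using \<alpha> by (simp add: field_simps)
    then have "\<alpha> * d * n = (- \<alpha> + p * (1 - \<alpha>) - \<alpha> * e) * n" by simp
    moreover have "q n (\<alpha> * n + d) = \<alpha> * d * n + \<alpha> * n * (1 - p) + p * ((2 * \<alpha> - 1) * n)
        + (d * (d + 1 - p) + p * (p - (p + 1) * \<alpha>))"
      unfolding q_def by (simp add: power2_eq_square algebra_simps)
    ultimately show ?thesis by (simp add: algebra_simps)
  qed
  moreover have "eventually (\<lambda>n. - (\<alpha> * e) * real n + (d * (d + 1 - p) + p * (p - (p + 1) * \<alpha>)) < 0) sequentially"
  proof -
    have "0 < \<alpha> * e" using \<alpha> e by simp
    then show ?thesis by real_asymp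
  qed
  ultimately have ev: "eventually (\<lambda>n. q (real n) (\<alpha> * real n + d) < 0) sequentially" by simp
  have "eventually (\<lambda>n. \<alpha> * p + 1 < \<alpha> * real n + d) sequentially"
    using \<alpha> by real_asymp
  with ev show ?thesis
  proof eventually_elim
    case (elim n)
    then show ?case using split_radius_gt[of "\<alpha> * real n + d" \<alpha> "real n" p]
      unfolding q_def d_def by (auto simp: algebra_simps)
  qed
qed

lemma join_poly_root_exists:
  assumes \<alpha>: "\<alpha> < 1" and p: "0 < p" and m: "0 \<le> m"
    and s: "\<alpha> * p + 1 < s" "join_poly \<alpha> n p 0 s = 0"
  obtains t where "\<alpha> * p + 1 < t" "join_poly \<alpha> n p m t = 0"
proof -
  have "join_poly \<alpha> n p m s = join_poly \<alpha> n p 0 s - (1 - \<alpha>)\<^sup>2 * p * m"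
    unfolding join_poly_def by (simp add: algebra_simps)
  then have le: "join_poly \<alpha> n p m s \<le> 0" using s(2) p m by simp
  have "eventually (\<lambda>x. 0 < join_poly \<alpha> n p m x) at_top"
    unfolding join_poly_def by real_asymp
  then have "eventually (\<lambda>x. s \<le> x \<and> 0 < join_poly \<alpha> n p m x) at_top"
    using eventually_ge_at_top eventually_conj by blast
  then obtain x where x: "s \<le> x" "0 < join_poly \<alpha> n p m x"
    using eventually_happens[of _ "at_top :: real filter"] by auto
  have "\<exists>t\<ge>s. t \<le> x \<and> join_poly \<alpha> n p m t = 0"
    using le x unfolding join_poly_def by (intro IVT') (auto intro!: continuous_intros)
  then obtain t where "s \<le> t" "join_poly \<alpha> n p m t = 0" by blast
  then show thesis using s(1) by (intro that[of t]) auto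
qed

text \<open>The finiteness of the root set is needed because \<open>largest_root\<close> is a maximum of a set.\<close>
lemma largest_root_join_poly:
  assumes \<alpha>: "0 < \<alpha>" "\<alpha> < 1" and p: "1 \<le> p" "p \<le> n" and m: "0 \<le> m"
    and s: "\<alpha> * p + 1 < s" "join_poly \<alpha> n p m s = 0"
    and g: "\<And>x. g x = join_poly \<alpha> n p m x"
  shows "largest_root g = s"
  unfolding largest_root_def
proof (rule Max_eqI)
  define c where "c = \<alpha> * (n - 1) + (1 - \<alpha>) * (p - 1)"
  define P where "P = [:- c, 1:] * [:- (\<alpha> * p), 1:] * [:- (\<alpha> * p + 1), 1:]
    - [:(1 - \<alpha>)\<^sup>2 * p * (m - (n - p) * (\<alpha> * p + 1)), (1 - \<alpha>)\<^sup>2 * p * (n - p):]"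
  have P: "poly P x = g x" for x
    unfolding g P_def join_poly_def c_def by (simp add: algebra_simps)
  have "coeff P 3 = 1" unfolding P_def by (simp add: numeral_3_eq_3)
  then have "P \<noteq> 0" by auto
  then have "finite {x. poly P x = 0}" by (rule poly_roots_finite)
  then show "finite {x. g x = 0}" by (simp add: P)
  show "s \<in> {x. g x = 0}" using s g by simp
  show "x \<le> s" if "x \<in> {x. g x = 0}" for x
  proof (cases "\<alpha> * p + 1 < x")
    case True
    then show ?thesis using join_poly_root_mono[OF \<alpha> p True _ s m] that g by simp
  qed (use s in simp)
qed

lemma f_cubic_eq: "f_cubic \<alpha> n p x = join_poly \<alpha> n p 2 x"
  unfolding f_cubic_def join_poly_def
  by (simp add: algebra_simps power2_eq_square power3_eq_cube)

lemma f_cubic_eq_odd: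
  "f_cubic \<alpha> n p x - p * (\<alpha> - 1)\<^sup>2 * (n - p - 3) = join_poly \<alpha> n p (n - p - 1) x"
  unfolding f_cubic_eq join_poly_def by (simp add: algebra_simps power2_eq_square)

text \<open>A maximal matching on \<open>n - p\<close> vertices covers all of them if \<open>n - p\<close> is even, in which case the cubic
  factors, and all but one if \<open>n - p\<close> is odd.\<close>
lemma t_alpha_eq:
  fixes n p :: nat
  assumes \<alpha>: "0 < \<alpha>" "\<alpha> < 1" and p: "1 \<le> p" "p + 1 \<le> n"
    and s: "\<alpha> * real p + 1 < s" "join_poly \<alpha> (real n) (real p) (real (2 * ((n - p) div 2))) s = 0"
  shows "t_alpha \<alpha> n p = s"
proof (cases "even (n - p)")
  case True
  then have e: "real (2 * ((n - p) div 2)) = real n - real p" using p(2) by (simp add: of_nat_diff)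
  define b where "b = \<alpha> * real n + real p"
  define c where "c = (\<alpha> * real n + real p - 1 - \<alpha> * real p) * (\<alpha> * real p + 1)
    - (1 - \<alpha>)\<^sup>2 * real p * (real n - real p)"
  have fac: "join_poly \<alpha> (real n) (real p) (real n - real p) x = (x - \<alpha> * real p) * (x\<^sup>2 - b * x + c)" for x
    unfolding join_poly_def b_def c_def by (simp add: algebra_simps power2_eq_square)
  have t: "t_alpha \<alpha> n p = (b + sqrt (b\<^sup>2 - 4 * c)) / 2"
  proof -
    have "(\<alpha> * real n - 3 * real p) ^ 2 + 4 * (real p - \<alpha>) * real n
       + 4 * (real p + 2) * (\<alpha> * real p - 3 * real p + 5) - 36 = b\<^sup>2 - 4 * c"
      unfolding b_def c_def by (simp add: algebra_simps power2_eq_square)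
    then show ?thesis using True unfolding t_alpha_def b_def by (simp add: algebra_simps)
  qed
  have neg: "(\<alpha> * real p + 1)\<^sup>2 - b * (\<alpha> * real p + 1) + c < 0"
  proof -
    have "(\<alpha> * real p + 1)\<^sup>2 - b * (\<alpha> * real p + 1) + c = - ((1 - \<alpha>)\<^sup>2 * real p * (real n - real p))"
      unfolding b_def c_def by (simp add: algebra_simps power2_eq_square)
    also have "\<dots> < 0" using \<alpha> p by simp
    finally show ?thesis .
  qed
  have gt: "\<alpha> * real p + 1 < t_alpha \<alpha> n p"
    unfolding t using neg by (rule quadratic_root_gt)
  have root: "(t_alpha \<alpha> n p)\<^sup>2 - b * t_alpha \<alpha> n p + c = 0"
    unfolding t using neg by (rule quadratic_root_gt)
  have root': "join_poly \<alpha> (real n) (real p) (real n - real p) (t_alpha \<alpha> n p) = 0"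
    using root fac by simp
  have pn: "1 \<le> real p" "real p \<le> real n" "0 \<le> real n - real p" using p by auto
  show ?thesis
    using join_poly_root_mono[OF \<alpha> pn(1,2) gt root' s[unfolded e] pn(3) order_refl]
      join_poly_root_mono[OF \<alpha> pn(1,2) s[unfolded e] gt root' pn(3) order_refl] by simp
next
  case False
  then have e: "real (2 * ((n - p) div 2)) = real n - real p - 1"
    using p(2) by (simp add: of_nat_diff odd_two_times_div_two_nat)
  have "largest_root (\<lambda>x. f_cubic \<alpha> (real n) (real p) x
      - real p * (\<alpha> - 1) ^ 2 * (real n - real p - 3)) = s"
    using \<alpha> p s[unfolded e] f_cubic_eq_odd by (intro largest_root_join_poly) auto
  then show ?thesis using False unfolding t_alpha_def by simp
qed

section \<open>Isomorphisms\<close>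

text \<open>A bijection between the vertex sets that preserves and reflects arcs.\<close>
definition arc_iso :: "'a set \<Rightarrow> 'a rel \<Rightarrow> 'b set \<Rightarrow> 'b rel \<Rightarrow> ('a \<Rightarrow> 'b) \<Rightarrow> bool" where
  "arc_iso V E V' E' \<phi> \<longleftrightarrow> bij_betw \<phi> V V' \<and> (\<forall>u\<in>V. \<forall>v\<in>V. (u, v) \<in> E \<longleftrightarrow> (\<phi> u, \<phi> v) \<in> E')"

lemma wf_digraph_with_proj: "parcs G \<subseteq> pverts G \<times> pverts G \<Longrightarrow> wf_digraph (with_proj G)"
  by unfold_locales auto

lemma digraph_iso_with_projI:
  assumes "parcs G \<subseteq> pverts G \<times> pverts G" "inj_on \<phi> (pverts G)"
    and "pverts H = \<phi> ` pverts G" "parcs H = map_prod \<phi> \<phi> ` parcs G"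
  shows "digraph_iso (with_proj G) (with_proj H)"
proof -
  define f where "f = \<lparr>iso_verts = \<phi>, iso_arcs = map_prod \<phi> \<phi>, iso_head = snd, iso_tail = fst\<rparr>"
  have "inj_on (map_prod \<phi> \<phi>) (parcs G)"
    using map_prod_inj_on[OF assms(2,2)] assms(1) by (rule inj_on_subset)
  then have "pre_digraph.digraph_isomorphism (with_proj G) f"
    using assms wf_digraph_with_proj[OF assms(1)]
    by (auto simp: pre_digraph.digraph_isomorphism_def f_def)
  moreover have "with_proj H = app_iso f (with_proj G)"
    unfolding app_iso_def f_def using assms(3,4) by (simp add: with_proj_def)
  ultimately show ?thesis unfolding digraph_iso_def by blast
qed

lemma digraph_iso_with_proj_iff:
  assumes G: "parcs G \<subseteq> pverts G \<times> pverts G" and H: "parcs H \<subseteq> pverts H \<times> pverts H"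
  shows "digraph_iso (with_proj G) (with_proj H) \<longleftrightarrow>
    (\<exists>\<phi>. arc_iso (pverts G) (parcs G) (pverts H) (parcs H) \<phi>)"
proof
  assume "digraph_iso (with_proj G) (with_proj H)"
  then obtain f where f: "pre_digraph.digraph_isomorphism (with_proj G) f"
    and HG: "with_proj H = app_iso f (with_proj G)" unfolding digraph_iso_def by blast
  define \<phi> where "\<phi> = iso_verts f"
  have tl: "iso_tail f = fst" "iso_head f = snd"
    using arg_cong[OF HG, of tail] arg_cong[OF HG, of head] by (simp_all add: app_iso_def)
  have inj: "inj_on \<phi> (pverts G)" using f unfolding pre_digraph.digraph_isomorphism_def \<phi>_def by simp
  have vs: "pverts H = \<phi> ` pverts G" using arg_cong[OF HG, of verts] by (simp add: app_iso_def \<phi>_def)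
  have arc: "iso_arcs f a = map_prod \<phi> \<phi> a" if "a \<in> parcs G" for a
    using f that tl unfolding pre_digraph.digraph_isomorphism_def \<phi>_def
    by (intro prod_eqI) auto
  have as: "parcs H = map_prod \<phi> \<phi> ` parcs G"
    using arg_cong[OF HG, of arcs] arc by (simp add: app_iso_def)
  have "(u, v) \<in> parcs G \<longleftrightarrow> (\<phi> u, \<phi> v) \<in> parcs H" if "u \<in> pverts G" "v \<in> pverts G" for u v
  proof
    assume "(\<phi> u, \<phi> v) \<in> parcs H"
    then obtain u' v' where uv: "(u', v') \<in> parcs G" "\<phi> u = \<phi> u'" "\<phi> v = \<phi> v'"
      unfolding as by auto
    moreover have "u' \<in> pverts G" "v' \<in> pverts G" using uv(1) G by auto
    ultimately show "(u, v) \<in> parcs G" using inj that by (metis inj_onD)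
  qed (auto simp: as)
  then show "\<exists>\<phi>. arc_iso (pverts G) (parcs G) (pverts H) (parcs H) \<phi>"
    unfolding arc_iso_def bij_betw_def using inj vs by blast
next
  assume "\<exists>\<phi>. arc_iso (pverts G) (parcs G) (pverts H) (parcs H) \<phi>"
  then obtain \<phi> where \<phi>: "bij_betw \<phi> (pverts G) (pverts H)"
    and E: "\<And>u v. u \<in> pverts G \<Longrightarrow> v \<in> pverts G \<Longrightarrow> (u, v) \<in> parcs G \<longleftrightarrow> (\<phi> u, \<phi> v) \<in> parcs H"
    unfolding arc_iso_def by blast
  show "digraph_iso (with_proj G) (with_proj H)"
  proof (rule digraph_iso_with_projI[OF G])
    show "inj_on \<phi> (pverts G)" "pverts H = \<phi> ` pverts G" using \<phi> by (auto simp: bij_betw_def)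
    show "parcs H = map_prod \<phi> \<phi> ` parcs G"
    proof (intro subset_antisym subsetI)
      fix a assume a: "a \<in> parcs H"
      then have "fst a \<in> \<phi> ` pverts G" "snd a \<in> \<phi> ` pverts G" using H \<phi> by (auto simp: bij_betw_def)
      then obtain u v where uv: "u \<in> pverts G" "v \<in> pverts G" "a = (\<phi> u, \<phi> v)" by (metis imageE prod.collapse)
      then have "(u, v) \<in> parcs G" using a E by simp
      then show "a \<in> map_prod \<phi> \<phi> ` parcs G" using uv(3) by force
    next
      fix a assume "a \<in> map_prod \<phi> \<phi> ` parcs G"
      then obtain u v where "(u, v) \<in> parcs G" "a = (\<phi> u, \<phi> v)" by auto
      then show "a \<in> parcs H" using E G by auto
    qed
  qed
qed

text \<open>The vertex \<open>j\<close> of the component \<open>i\<close> is mapped to the entry \<open>j\<close> of the list of the \<open>i\<close>-th path.\<close>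
lemma not_graph_free:
  assumes G: "pair_graph G" and F: "has_forest (parcs G) {1..l} k (pverts G)"
  shows "\<not> graph_free (linear_forest l k) G"
proof -
  interpret fin_graph "pverts G" "parcs G" by (rule pair_graph_fin_graph[OF G])
  let ?F = "linear_forest l k"
  obtain ps where ps: "packs_paths (parcs G) {1..l} k (pverts G) ps"
    using F unfolding has_forest_def by blast
  define \<phi> where "\<phi> = (\<lambda>(i, j). ps i ! j)"
  have len: "length (ps i) = k i" and dis: "distinct (ps i)" and sub: "set (ps i) \<subseteq> pverts G"
    and suc: "successively (\<lambda>u v. (u, v) \<in> parcs G) (ps i)" if "i \<in> {1..l}" for i
    using ps that unfolding packs_paths_def by blast+
  have disj: "set (ps i) \<inter> set (ps j) = {}" if "i \<in> {1..l}" "j \<in> {1..l}" "i \<noteq> j" for i j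
    using ps that unfolding packs_paths_def by blast
  have VF: "pverts ?F = (SIGMA i:{1..l}. {..<k i})"
    by (simp add: linear_forest_def disjoint_Union_def path_graph_def)
  have AF: "((i, u), (j, v)) \<in> parcs ?F \<longleftrightarrow>
      i = j \<and> i \<in> {1..l} \<and> u < k i \<and> v < k i \<and> (v = Suc u \<or> u = Suc v)" for i j u v
    by (auto simp: linear_forest_def disjoint_Union_def path_graph_def)
  have wF: "parcs ?F \<subseteq> pverts ?F \<times> pverts ?F" using AF VF by (auto simp: mem_Sigma_iff)
  have inj: "inj_on \<phi> (pverts ?F)"
  proof (rule inj_onI, clarify)
    fix i u j v
    assume a: "(i, u) \<in> pverts ?F" "(j, v) \<in> pverts ?F" "\<phi> (i, u) = \<phi> (j, v)"
    then have i: "i \<in> {1..l}" "u < k i" and j: "j \<in> {1..l}" "v < k j" unfolding VF by auto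
    have eq: "ps i ! u = ps j ! v" using a(3) by (simp add: \<phi>_def)
    have "ps i ! u \<in> set (ps i)" "ps j ! v \<in> set (ps j)" using i j len by simp_all
    then have "i = j" using disj[OF i(1) j(1)] eq by (metis disjoint_iff)
    moreover have "u = v" using eq dis[OF i(1)] i j len \<open>i = j\<close> by (simp add: nth_eq_iff_index_eq)
    ultimately show "i = j \<and> u = v" by simp
  qed
  define H where "H = \<lparr>pverts = \<phi> ` pverts ?F, parcs = map_prod \<phi> \<phi> ` parcs ?F\<rparr>"
  have step: "(ps i ! u, ps i ! Suc u) \<in> parcs G" if "i \<in> {1..l}" "Suc u < k i" for i u
    using suc[OF that(1)] len[OF that(1)] that(2) by (simp add: successively_conv_nth)
  have "parcs H \<subseteq> parcs G"
  proof
    fix a assume "a \<in> parcs H"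
    then obtain i u j v where a: "((i, u), (j, v)) \<in> parcs ?F" "a = (\<phi> (i, u), \<phi> (j, v))"
      unfolding H_def by auto
    then show "a \<in> parcs G" unfolding AF \<phi>_def using step E_sym by auto
  qed
  moreover have "pverts H \<subseteq> pverts G"
    unfolding H_def VF \<phi>_def using len sub by (auto intro!: subsetD[OF sub] nth_mem)
  moreover have "parcs H \<subseteq> pverts H \<times> pverts H" unfolding H_def using wF by auto
  ultimately have "subgraph (with_proj H) (with_proj G)"
    using E_sub by (auto simp: subgraph_def intro!: wf_digraph_with_proj)
  moreover have "digraph_iso (with_proj ?F) (with_proj H)"
    using wF inj by (intro digraph_iso_with_projI) (simp_all add: H_def)
  then have "digraph_iso (with_proj H) (with_proj ?F)"
    by (rule digraph_iso_swap[OF wf_digraph_with_proj[OF wF]])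
  ultimately show ?thesis unfolding graph_free_def by blast
qed

text \<open>Removing one pair from a fixed-point-free involution leaves such an involution; this drives the next
  two inductions.\<close>
lemma involution_pair:
  assumes "finite A" "a \<in> A" "\<And>a. a \<in> A \<Longrightarrow> \<sigma> a \<in> A \<and> \<sigma> (\<sigma> a) = a \<and> \<sigma> a \<noteq> a"
  shows "card A = card (A - {a, \<sigma> a}) + 2"
    and "\<And>b. b \<in> A - {a, \<sigma> a} \<Longrightarrow> \<sigma> b \<in> A - {a, \<sigma> a} \<and> \<sigma> (\<sigma> b) = b \<and> \<sigma> b \<noteq> b"
proof -
  have "card {a, \<sigma> a} = 2" using assms(2,3) by (metis card_2_iff)
  moreover have sub: "{a, \<sigma> a} \<subseteq> A" using assms(2,3) by simp
  moreover have "card {a, \<sigma> a} \<le> card A" using assms(1) sub by (rule card_mono)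
  ultimately show "card A = card (A - {a, \<sigma> a}) + 2" by (simp add: card_Diff_subset)
  show "\<sigma> b \<in> A - {a, \<sigma> a} \<and> \<sigma> (\<sigma> b) = b \<and> \<sigma> b \<noteq> b" if "b \<in> A - {a, \<sigma> a}" for b
    using that assms(2) assms(3)[of b] assms(3)[of a] by (metis Diff_iff insert_iff singletonD)
qed

lemma even_card_involution:
  assumes "finite A" "\<And>a. a \<in> A \<Longrightarrow> \<sigma> a \<in> A \<and> \<sigma> (\<sigma> a) = a \<and> \<sigma> a \<noteq> a"
  shows "even (card A)"
  using assms
proof (induction "card A" arbitrary: A rule: less_induct)
  case less
  show ?case
  proof (cases "A = {}")
    case False
    then obtain a where a: "a \<in> A" by blast
    note ip = involution_pair[of A a \<sigma>, OF less.prems(1) a less.prems(2)]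
    have "even (card (A - {a, \<sigma> a}))"
      using less.prems(1) ip by (intro less.hyps) auto
    then show ?thesis using ip(1) by simp
  qed simp
qed

text \<open>Two perfect matchings of the same size, given as fixed-point-free involutions, are isomorphic.\<close>
lemma involutions_conjugate:
  assumes "finite A" "finite B" "card A = card B"
    and "\<And>a. a \<in> A \<Longrightarrow> \<sigma> a \<in> A \<and> \<sigma> (\<sigma> a) = a \<and> \<sigma> a \<noteq> a"
    and "\<And>b. b \<in> B \<Longrightarrow> \<tau> b \<in> B \<and> \<tau> (\<tau> b) = b \<and> \<tau> b \<noteq> b"
  shows "\<exists>g. bij_betw g A B \<and> (\<forall>a\<in>A. g (\<sigma> a) = \<tau> (g a))"
  using assms
proof (induction "card A" arbitrary: A B rule: less_induct)
  case less
  show ?case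
  proof (cases "A = {}")
    case True
    then show ?thesis using less.prems by (auto simp: bij_betw_def)
  next
    case False
    then obtain a where a: "a \<in> A" by blast
    then have "card A \<noteq> 0" using less.prems(1) by auto
    then have "card B \<noteq> 0" using less.prems(3) by simp
    then obtain b where b: "b \<in> B" by fastforce
    let ?A = "A - {a, \<sigma> a}" and ?B = "B - {b, \<tau> b}"
    note ipA = involution_pair[of A a \<sigma>, OF less.prems(1) a less.prems(4)]
    note ipB = involution_pair[of B b \<tau>, OF less.prems(2) b less.prems(5)]
    have "\<exists>g. bij_betw g ?A ?B \<and> (\<forall>a\<in>?A. g (\<sigma> a) = \<tau> (g a))"
    proof (rule less.hyps)
      show "card ?A < card A" using ipA(1) by simp
      show "card ?A = card ?B" using ipA(1) ipB(1) less.prems(3) by simp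
    qed (use less.prems(1,2) ipA(2) ipB(2) in auto)
    then obtain g where g: "bij_betw g ?A ?B" "\<And>c. c \<in> ?A \<Longrightarrow> g (\<sigma> c) = \<tau> (g c)" by blast
    define h where "h = (\<lambda>c. if c = a then b else if c = \<sigma> a then \<tau> b else g c)"
    have sa: "\<sigma> a \<in> A" "\<sigma> (\<sigma> a) = a" "\<sigma> a \<noteq> a" using less.prems(4)[OF a] by auto
    have tb: "\<tau> b \<in> B" "\<tau> (\<tau> b) = b" "\<tau> b \<noteq> b" using less.prems(5)[OF b] by auto
    have "bij_betw h {a, \<sigma> a} {b, \<tau> b}"
      using sa tb by (auto simp: bij_betw_def h_def inj_on_def)
    moreover have "bij_betw h ?A ?B"
      using g(1) by (rule bij_betw_cong[THEN iffD1, rotated]) (auto simp: h_def)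
    ultimately have "bij_betw h ({a, \<sigma> a} \<union> ?A) ({b, \<tau> b} \<union> ?B)"
      by (rule bij_betw_combine) auto
    moreover have "{a, \<sigma> a} \<union> ?A = A" "{b, \<tau> b} \<union> ?B = B" using a b sa tb by auto
    moreover have "h (\<sigma> c) = \<tau> (h c)" if c: "c \<in> A" for c
    proof (cases "c \<in> ?A")
      case True
      then have "\<sigma> c \<in> ?A" using ipA(2) by blast
      then show ?thesis using True g(2)[OF True] by (auto simp: h_def)
    next
      case False
      then have "c = a \<or> c = \<sigma> a" using c by blast
      then show ?thesis using sa tb by (auto simp: h_def)
    qed
    ultimately show ?thesis by auto
  qed
qed

context fin_graph
begin

text \<open>The arcs outside \<open>M\<close> as a fixed-point-free involution on the matched vertices.\<close>
lemma matched_join_partner: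
  assumes "matched_join V E p m M"
  obtains \<sigma> where "\<And>a. a \<in> inner_vertices V E M \<Longrightarrow>
      \<sigma> a \<in> inner_vertices V E M \<and> \<sigma> (\<sigma> a) = a \<and> \<sigma> a \<noteq> a"
    and "\<And>u v. u \<in> V - M \<Longrightarrow> v \<in> V - M \<Longrightarrow> (u, v) \<in> E \<longleftrightarrow> u \<in> inner_vertices V E M \<and> v = \<sigma> u"
proof -
  let ?J = "inner_vertices V E M"
  have uni: "\<And>u v w. u \<in> V - M \<Longrightarrow> v \<in> V - M \<Longrightarrow> w \<in> V - M \<Longrightarrow> (u, v) \<in> E \<Longrightarrow> (u, w) \<in> E \<Longrightarrow> v = w"
    using assms unfolding matched_join_def by blast
  have "\<forall>u\<in>?J. \<exists>w. w \<in> V - M \<and> (u, w) \<in> E" unfolding inner_vertices_def by blast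
  then obtain \<sigma> where "\<forall>u\<in>?J. \<sigma> u \<in> V - M \<and> (u, \<sigma> u) \<in> E" by (rule bchoice[THEN exE])
  then have s: "\<sigma> u \<in> V - M \<and> (u, \<sigma> u) \<in> E" if "u \<in> ?J" for u using that by blast
  have J: "u \<in> V - M" if "u \<in> ?J" for u using that unfolding inner_vertices_def by blast
  have sJ: "\<sigma> u \<in> ?J" if "u \<in> ?J" for u
    using s[OF that] J[OF that] E_sym[of u "\<sigma> u"] unfolding inner_vertices_def by blast
  show thesis
  proof (rule that)
    fix a assume a: "a \<in> ?J"
    have "(\<sigma> a, a) \<in> E" using s[OF a] E_sym by blast
    then have "\<sigma> (\<sigma> a) = a" using uni s[OF sJ[OF a]] s[OF a] J[OF a] by blast
    moreover have "\<sigma> a \<noteq> a" using s[OF a] E_irrefl by metis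
    ultimately show "\<sigma> a \<in> ?J \<and> \<sigma> (\<sigma> a) = a \<and> \<sigma> a \<noteq> a" using sJ[OF a] by blast
  next
    fix u v assume uv: "u \<in> V - M" "v \<in> V - M"
    show "(u, v) \<in> E \<longleftrightarrow> u \<in> ?J \<and> v = \<sigma> u"
    proof
      assume e: "(u, v) \<in> E"
      then have "u \<in> ?J" using uv unfolding inner_vertices_def by blast
      then show "u \<in> ?J \<and> v = \<sigma> u" using uni[OF uv(1,2) _ e] s by blast
    qed (use s in blast)
  qed
qed

lemma matched_join_even:
  assumes "matched_join V E p m M" shows "even m"
proof -
  obtain \<sigma> where \<sigma>: "\<And>a. a \<in> inner_vertices V E M \<Longrightarrow>
      \<sigma> a \<in> inner_vertices V E M \<and> \<sigma> (\<sigma> a) = a \<and> \<sigma> a \<noteq> a"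
    by (rule matched_join_partner[OF assms]) (rule that)
  have "finite (inner_vertices V E M)" using finite_V unfolding inner_vertices_def by simp
  then have "even (card (inner_vertices V E M))" using \<sigma> by (rule even_card_involution)
  then show ?thesis using assms unfolding matched_join_def by simp
qed

lemma matched_join_iso:
  assumes M: "matched_join V E p m M" and \<phi>: "arc_iso V E V' E' \<phi>"
  shows "matched_join V' E' p m (\<phi> ` M)"
proof -
  have inj: "inj_on \<phi> V" and im: "V' = \<phi> ` V" and E: "\<And>u v. u \<in> V \<Longrightarrow> v \<in> V \<Longrightarrow> (\<phi> u, \<phi> v) \<in> E' \<longleftrightarrow> (u, v) \<in> E"
    using \<phi> unfolding arc_iso_def bij_betw_def by auto
  have dom: "M \<subseteq> V" "\<And>u v. u \<in> M \<Longrightarrow> v \<in> V \<Longrightarrow> u \<noteq> v \<Longrightarrow> (u, v) \<in> E"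
    and cM: "card M = p" and cJ: "card (inner_vertices V E M) = m"
    and uni: "\<And>u v w. u \<in> V - M \<Longrightarrow> v \<in> V - M \<Longrightarrow> w \<in> V - M \<Longrightarrow> (u, v) \<in> E \<Longrightarrow> (u, w) \<in> E \<Longrightarrow> v = w"
    using M unfolding matched_join_def dominating_def by blast+
  have diff: "V' - \<phi> ` M = \<phi> ` (V - M)" unfolding im using inj dom(1) by (simp add: inj_on_image_set_diff)
  have inner: "inner_vertices V' E' (\<phi> ` M) = \<phi> ` inner_vertices V E M"
    unfolding inner_vertices_def diff using E by auto
  have "dominating V' E' (\<phi> ` M)"
    unfolding dominating_def
  proof (intro conjI ballI impI)
    show "\<phi> ` M \<subseteq> V'" unfolding im using dom(1) by (rule image_mono)
    fix a b assume "a \<in> \<phi> ` M" "b \<in> V'" "a \<noteq> b"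
    then obtain u v where uv: "u \<in> M" "v \<in> V" "a = \<phi> u" "b = \<phi> v" "u \<noteq> v" unfolding im by blast
    then show "(a, b) \<in> E'" using dom E[of u v] by blast
  qed
  moreover have "card (\<phi> ` M) = p" using cM card_image[OF inj_on_subset[OF inj dom(1)]] by simp
  moreover have "card (\<phi> ` inner_vertices V E M) = m"
  proof -
    have "inner_vertices V E M \<subseteq> V" unfolding inner_vertices_def by blast
    then show ?thesis using cJ card_image[OF inj_on_subset[OF inj]] by metis
  qed
  moreover have "v = w" if uvw: "u \<in> V' - \<phi> ` M" "v \<in> V' - \<phi> ` M" "w \<in> V' - \<phi> ` M" "(u, v) \<in> E'" "(u, w) \<in> E'" for u v w
  proof -
    obtain u' v' w' where "u' \<in> V - M" "v' \<in> V - M" "w' \<in> V - M" "u = \<phi> u'" "v = \<phi> v'" "w = \<phi> w'"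
      using uvw(1-3) unfolding diff by blast
    then show ?thesis using uvw(4,5) E uni[of u' v' w'] by auto
  qed
  ultimately show ?thesis unfolding matched_join_def inner by blast
qed

end

text \<open>The bijection is glued from bijections between the cliques, the matched vertices and the remaining
  vertices.\<close>
lemma iso_of_matched_joins:
  assumes "fin_graph V E" "fin_graph V' E'" "card V = card V'"
    and M: "matched_join V E p m M" and M': "matched_join V' E' p m M'"
  shows "\<exists>\<phi>. arc_iso V E V' E' \<phi>"
proof -
  interpret G: fin_graph V E by fact
  interpret H: fin_graph V' E' by fact
  let ?J = "inner_vertices V E M" and ?J' = "inner_vertices V' E' M'"
  obtain \<sigma> where \<sigma>: "\<And>a. a \<in> ?J \<Longrightarrow> \<sigma> a \<in> ?J \<and> \<sigma> (\<sigma> a) = a \<and> \<sigma> a \<noteq> a"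
    "\<And>u v. u \<in> V - M \<Longrightarrow> v \<in> V - M \<Longrightarrow> (u, v) \<in> E \<longleftrightarrow> u \<in> ?J \<and> v = \<sigma> u"
    by (rule G.matched_join_partner[OF M]) (rule that)
  obtain \<tau> where \<tau>: "\<And>a. a \<in> ?J' \<Longrightarrow> \<tau> a \<in> ?J' \<and> \<tau> (\<tau> a) = a \<and> \<tau> a \<noteq> a"
    "\<And>u v. u \<in> V' - M' \<Longrightarrow> v \<in> V' - M' \<Longrightarrow> (u, v) \<in> E' \<longleftrightarrow> u \<in> ?J' \<and> v = \<tau> u"
    by (rule H.matched_join_partner[OF M']) (rule that)
  have dom: "M \<subseteq> V" "\<And>u v. u \<in> M \<Longrightarrow> v \<in> V \<Longrightarrow> u \<noteq> v \<Longrightarrow> (u, v) \<in> E"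
    and c: "card M = p" "card ?J = m"
    using M unfolding matched_join_def dominating_def by blast+
  have dom': "M' \<subseteq> V'" "\<And>u v. u \<in> M' \<Longrightarrow> v \<in> V' \<Longrightarrow> u \<noteq> v \<Longrightarrow> (u, v) \<in> E'"
    and c': "card M' = p" "card ?J' = m"
    using M' unfolding matched_join_def dominating_def by blast+
  have J: "?J \<subseteq> V - M" and J': "?J' \<subseteq> V' - M'" unfolding inner_vertices_def by blast+
  have fin: "finite M" "finite ?J" "finite M'" "finite ?J'"
    using G.finite_V H.finite_V dom(1) dom'(1) J J' by (auto intro: finite_subset)
  obtain f where f: "bij_betw f M M'" using finite_same_card_bij[of M M'] fin c c' by auto
  obtain g where g: "bij_betw g ?J ?J'" "\<And>a. a \<in> ?J \<Longrightarrow> g (\<sigma> a) = \<tau> (g a)"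
    using involutions_conjugate[of ?J ?J' \<sigma> \<tau>] fin c c' \<sigma>(1) \<tau>(1) by auto
  have "card (V - M - ?J) = card (V' - M' - ?J')"
    using dom(1) dom'(1) J J' fin c c' assms(3) G.finite_V H.finite_V by (simp add: card_Diff_subset)
  then obtain h where h: "bij_betw h (V - M - ?J) (V' - M' - ?J')"
    using finite_same_card_bij[of "V - M - ?J" "V' - M' - ?J'"] G.finite_V H.finite_V by auto
  define \<phi> where "\<phi> = (\<lambda>v. if v \<in> M then f v else if v \<in> ?J then g v else h v)"
  have \<phi>M: "bij_betw \<phi> M M'" using f by (rule bij_betw_cong[THEN iffD1, rotated]) (simp add: \<phi>_def)
  have \<phi>J: "bij_betw \<phi> ?J ?J'"
    using g(1) by (rule bij_betw_cong[THEN iffD1, rotated]) (use J in \<open>auto simp: \<phi>_def\<close>)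
  have "bij_betw \<phi> (V - M - ?J) (V' - M' - ?J')"
    using h by (rule bij_betw_cong[THEN iffD1, rotated]) (auto simp: \<phi>_def)
  then have "bij_betw \<phi> (?J \<union> (V - M - ?J)) (?J' \<union> (V' - M' - ?J'))"
    using \<phi>J by (intro bij_betw_combine) auto
  moreover have "?J \<union> (V - M - ?J) = V - M" "?J' \<union> (V' - M' - ?J') = V' - M'" using J J' by auto
  ultimately have \<phi>R: "bij_betw \<phi> (V - M) (V' - M')" by simp
  have "bij_betw \<phi> (M \<union> (V - M)) (M' \<union> (V' - M'))"
    using \<phi>M \<phi>R by (rule bij_betw_combine) auto
  moreover have "M \<union> (V - M) = V" "M' \<union> (V' - M') = V'" using dom(1) dom'(1) by auto
  ultimately have bij: "bij_betw \<phi> V V'" by simp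
  have \<phi>sub: "\<phi> v \<in> V'" if "v \<in> V" for v using bij that by (auto simp: bij_betw_def)
  have \<phi>eq: "\<phi> u = \<phi> v \<longleftrightarrow> u = v" if "u \<in> V" "v \<in> V" for u v
    using bij that by (auto simp: bij_betw_def inj_on_def)
  have \<phi>mem: "\<phi> v \<in> M' \<longleftrightarrow> v \<in> M" if "v \<in> V" for v
    using that \<phi>M \<phi>R unfolding bij_betw_def by blast
  have \<phi>mem': "\<phi> v \<in> ?J' \<longleftrightarrow> v \<in> ?J" if "v \<in> V" for v
  proof
    assume "\<phi> v \<in> ?J'"
    then obtain w where "w \<in> ?J" "\<phi> v = \<phi> w" using \<phi>J unfolding bij_betw_def by blast
    then show "v \<in> ?J" using \<phi>eq[OF that, of w] J by auto
  qed (use \<phi>J in \<open>auto simp: bij_betw_def\<close>)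
  have "(u, v) \<in> E \<longleftrightarrow> (\<phi> u, \<phi> v) \<in> E'" if uv: "u \<in> V" "v \<in> V" for u v
  proof (cases "u = v")
    case True
    then show ?thesis using G.E_irrefl H.E_irrefl by simp
  next
    case ne: False
    then have ne': "\<phi> u \<noteq> \<phi> v" using \<phi>eq[OF uv] by simp
    show ?thesis
    proof (cases "u \<in> M \<or> v \<in> M")
      case True
      have "(u, v) \<in> E" using True ne uv dom(2) G.E_sym by metis
      moreover have "(\<phi> u, \<phi> v) \<in> E'" using True ne' uv \<phi>sub \<phi>mem dom'(2) H.E_sym by metis
      ultimately show ?thesis by simp
    next
      case False
      then have R: "u \<in> V - M" "v \<in> V - M" "\<phi> u \<in> V' - M'" "\<phi> v \<in> V' - M'"
        using uv \<phi>mem \<phi>sub by auto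
      show ?thesis
      proof (cases "u \<in> ?J")
        case True
        have su: "\<sigma> u \<in> ?J" using \<sigma>(1)[OF True] by blast
        have "\<phi> (\<sigma> u) = \<tau> (\<phi> u)"
          using g(2)[OF True] True su J by (auto simp: \<phi>_def)
        then show ?thesis
          unfolding \<sigma>(2)[OF R(1,2)] \<tau>(2)[OF R(3,4)]
          using True \<phi>mem'[OF uv(1)] \<phi>eq[OF uv(2), of "\<sigma> u"] su J by auto
      next
        case False
        then show ?thesis
          unfolding \<sigma>(2)[OF R(1,2)] \<tau>(2)[OF R(3,4)] using \<phi>mem'[OF uv(1)] by simp
      qed
    qed
  qed
  then show ?thesis unfolding arc_iso_def using bij by blast
qed

section \<open>Extremal graphs\<close>

text \<open>In the join of a clique with \<open>H\<close>, the graph outside the clique is \<open>H\<close>; so the join is matched if the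
  edges of \<open>H\<close> form a matching.\<close>
lemma graph_join_matched:
  fixes H :: "'b pair_pre_digraph" and p :: nat
  assumes "fin_graph (pverts H) (parcs H)" "card {v. \<exists>w. (v, w) \<in> parcs H} = m"
    and "\<forall>u v w. (u, v) \<in> parcs H \<longrightarrow> (u, w) \<in> parcs H \<longrightarrow> v = w"
  defines "G \<equiv> graph_join (complete_graph p) H"
  shows "fin_graph (pverts G) (parcs G)" "card (pverts G) = p + card (pverts H)"
    and "matched_join (pverts G) (parcs G) p m (Inl ` {..<p})"
proof -
  interpret H: fin_graph "pverts H" "parcs H" by fact
  have VG: "pverts G = Inl ` {..<p} \<union> Inr ` pverts H"
    unfolding G_def by (simp add: graph_join_def disjoint_union_def complete_graph_def Plus_def)
  have LL: "(Inl i, Inl j) \<in> parcs G \<longleftrightarrow> i < p \<and> j < p \<and> i \<noteq> j"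
    and RR: "(Inr u, Inr v) \<in> parcs G \<longleftrightarrow> (u, v) \<in> parcs H"
    and LR: "(Inl i, Inr v) \<in> parcs G \<longleftrightarrow> i < p \<and> v \<in> pverts H"
    and RL: "(Inr v, Inl i) \<in> parcs G \<longleftrightarrow> i < p \<and> v \<in> pverts H" for i j u v
    unfolding G_def by (auto simp: graph_join_def disjoint_union_def complete_graph_def)
  note arcs = LL RR LR RL
  show "fin_graph (pverts G) (parcs G)"
  proof
    show "finite (pverts G)" unfolding VG using H.finite_V by simp
    show "parcs G \<subseteq> pverts G \<times> pverts G"
    proof (intro subsetI, clarify)
      fix a b assume "(a, b) \<in> parcs G"
      then show "a \<in> pverts G \<and> b \<in> pverts G"
        unfolding VG using H.E_sub by (cases a; cases b) (auto simp: arcs)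
    qed
    show "(v, u) \<in> parcs G" if "(u, v) \<in> parcs G" for u v
      using that by (cases u; cases v) (auto simp: arcs intro: H.E_sym)
    show "(v, v) \<notin> parcs G" for v by (cases v) (auto simp: arcs H.E_irrefl)
  qed
  show "card (pverts G) = p + card (pverts H)"
    unfolding VG using H.finite_V by (subst card_Un_disjoint) (auto simp: card_image)
  have rest: "pverts G - Inl ` {..<p} = Inr ` pverts H" unfolding VG by auto
  have "inner_vertices (pverts G) (parcs G) (Inl ` {..<p}) = Inr ` {v. \<exists>w. (v, w) \<in> parcs H}"
    unfolding inner_vertices_def rest using H.E_sub by (auto simp: arcs intro!: imageI)
  then have "card (inner_vertices (pverts G) (parcs G) (Inl ` {..<p})) = m"
    using assms(2) by (simp add: card_image)
  moreover have "dominating (pverts G) (parcs G) (Inl ` {..<p})"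
    unfolding dominating_def VG by (auto simp: arcs)
  moreover have "v = w" if uvw: "u \<in> Inr ` pverts H" "v \<in> Inr ` pverts H" "w \<in> Inr ` pverts H"
    and E: "(u, v) \<in> parcs G" "(u, w) \<in> parcs G" for u v w
  proof -
    obtain u' v' w' where eq: "u = Inr u'" "v = Inr v'" "w = Inr w'" using uvw by blast
    then have "(u', v') \<in> parcs H" "(u', w') \<in> parcs H" using E RR by simp_all
    then have "v' = w'" using assms(3) by blast
    then show ?thesis using eq by simp
  qed
  moreover have "card (Inl ` {..<p} :: (nat + 'b) set) = p" by (simp add: card_image)
  ultimately show "matched_join (pverts G) (parcs G) p m (Inl ` {..<p})"
    unfolding matched_join_def rest by blast
qed

lemma fin_graph_disjoint_union:
  assumes "fin_graph (pverts G) (parcs G)" "fin_graph (pverts H) (parcs H)"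
  shows "fin_graph (pverts (disjoint_union G H)) (parcs (disjoint_union G H))"
proof -
  interpret G: fin_graph "pverts G" "parcs G" by fact
  interpret H: fin_graph "pverts H" "parcs H" by fact
  show ?thesis
    by unfold_locales
      (use G.finite_V H.finite_V G.E_sub H.E_sub in
        \<open>auto simp: disjoint_union_def G.E_irrefl H.E_irrefl intro: G.E_sym H.E_sym\<close>)
qed

lemma fin_graph_complete: "fin_graph (pverts (complete_graph n)) (parcs (complete_graph n))"
  by unfold_locales (auto simp: complete_graph_def)

lemma fin_graph_complement_complete:
  "fin_graph (pverts (graph_complement (complete_graph n))) (parcs (graph_complement (complete_graph n)))"
  by unfold_locales (auto simp: complete_graph_def graph_complement_def)

lemma fin_graph_copies:
  assumes "fin_graph (pverts G) (parcs G)"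
  shows "fin_graph (pverts (graph_copies t G)) (parcs (graph_copies t G))"
proof -
  interpret G: fin_graph "pverts G" "parcs G" by fact
  show ?thesis
    by unfold_locales
      (use G.finite_V G.E_sub in \<open>auto simp: graph_copies_def disjoint_Union_def G.E_irrefl intro: G.E_sym\<close>)
qed

lemma S_graph_matched:
  assumes "p \<le> n"
  shows "fin_graph (pverts (S_graph n p)) (parcs (S_graph n p))" "card (pverts (S_graph n p)) = n"
    and "\<exists>M. matched_join (pverts (S_graph n p)) (parcs (S_graph n p)) p 0 M"
proof -
  let ?H = "graph_complement (complete_graph (n - p))"
  have H: "parcs ?H = {}" "card (pverts ?H) = n - p"
    by (auto simp: graph_complement_def complete_graph_def)
  note * = graph_join_matched[OF fin_graph_complement_complete[of "n - p"], where m = 0 and p = p]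
  show "fin_graph (pverts (S_graph n p)) (parcs (S_graph n p))" "card (pverts (S_graph n p)) = n"
    "\<exists>M. matched_join (pverts (S_graph n p)) (parcs (S_graph n p)) p 0 M"
    unfolding S_graph_def using * H assms by auto
qed

lemma S_plus_graph_matched:
  assumes "p + 2 \<le> n"
  shows "fin_graph (pverts (S_plus_graph n p)) (parcs (S_plus_graph n p))"
    and "card (pverts (S_plus_graph n p)) = n"
    and "\<exists>M. matched_join (pverts (S_plus_graph n p)) (parcs (S_plus_graph n p)) p 2 M"
proof -
  let ?H = "disjoint_union (graph_complement (complete_graph (n - p - 2))) (complete_graph 2)"
  have A: "parcs ?H = {(Inr 0, Inr 1), (Inr 1, Inr 0)}"
    by (auto simp: disjoint_union_def graph_complement_def complete_graph_def less_2_cases_iff)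
  have c: "card (pverts ?H) = n - p"
    using assms by (simp add: disjoint_union_def graph_complement_def complete_graph_def card_Plus)
  have "{v. \<exists>w. (v, w) \<in> parcs ?H} = {Inr 0, Inr 1}" unfolding A by auto
  then have d: "card {v. \<exists>w. (v, w) \<in> parcs ?H} = 2" by simp
  have u: "\<forall>u v w. (u, v) \<in> parcs ?H \<longrightarrow> (u, w) \<in> parcs ?H \<longrightarrow> v = w"
    unfolding A by auto
  note * = graph_join_matched[OF fin_graph_disjoint_union[OF fin_graph_complement_complete fin_graph_complete] d u,
      where p = p]
  show "fin_graph (pverts (S_plus_graph n p)) (parcs (S_plus_graph n p))"
    "card (pverts (S_plus_graph n p)) = n"
    "\<exists>M. matched_join (pverts (S_plus_graph n p)) (parcs (S_plus_graph n p)) p 2 M"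
    unfolding S_plus_graph_def using * c assms by auto
qed

lemma F_graph_matched:
  assumes "p \<le> n"
  shows "fin_graph (pverts (F_graph n p)) (parcs (F_graph n p))"
    and "card (pverts (F_graph n p)) = n"
    and "\<exists>M. matched_join (pverts (F_graph n p)) (parcs (F_graph n p)) p (2 * ((n - p) div 2)) M"
proof -
  let ?t = "(n - p) div 2" and ?r = "(n - p) mod 2"
  let ?H = "disjoint_union (graph_copies ?t (complete_graph 2)) (graph_copies ?r (complete_graph 1))"
  have A: "parcs ?H = {(Inl (i, a), Inl (i, b)) | i a b. i < ?t \<and> a < 2 \<and> b < 2 \<and> a \<noteq> b}"
    by (auto simp: disjoint_union_def graph_copies_def disjoint_Union_def complete_graph_def)
  have V: "pverts ?H = ({..<?t} \<times> {..<2}) <+> ({..<?r} \<times> {..<1})"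
    by (auto simp: disjoint_union_def graph_copies_def disjoint_Union_def complete_graph_def)
  have c: "card (pverts ?H) = n - p"
    unfolding V by (simp add: card_Plus)
  have "{v. \<exists>w. (v, w) \<in> parcs ?H} = Inl ` ({..<?t} \<times> {..<2})"
  proof (intro subset_antisym subsetI)
    fix v assume "v \<in> (Inl ` ({..<?t} \<times> {..<2}) :: (nat \<times> nat + nat \<times> nat) set)"
    then obtain i a where "v = Inl (i, a)" "i < ?t" "a < 2" by auto
    then have "(v, Inl (i, 1 - a)) \<in> parcs ?H" unfolding A by (auto simp: less_2_cases_iff)
    then show "v \<in> {v. \<exists>w. (v, w) \<in> parcs ?H}" by blast
  next
    fix v assume "v \<in> {v. \<exists>w. (v, w) \<in> parcs ?H}"
    then obtain w where "(v, w) \<in> parcs ?H" by blast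
    then show "v \<in> Inl ` ({..<?t} \<times> {..<2})" unfolding A by auto
  qed
  then have d: "card {v. \<exists>w. (v, w) \<in> parcs ?H} = 2 * ?t" by (simp add: card_image)
  have u: "\<forall>u v w. (u, v) \<in> parcs ?H \<longrightarrow> (u, w) \<in> parcs ?H \<longrightarrow> v = w"
    unfolding A by auto
  note * = graph_join_matched[OF fin_graph_disjoint_union[OF fin_graph_copies[OF fin_graph_complete] fin_graph_copies[OF fin_graph_complete]] d u,
      where p = p]
  show "fin_graph (pverts (F_graph n p)) (parcs (F_graph n p))"
    "card (pverts (F_graph n p)) = n"
    "\<exists>M. matched_join (pverts (F_graph n p)) (parcs (F_graph n p)) p (2 * ((n - p) div 2)) M"
    unfolding F_graph_def Let_def using * c assms by auto
qed

lemma digraph_iso_iff_matched_join: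
  assumes G: "pair_graph G" "card (pverts G) = n"
    and H: "fin_graph (pverts H) (parcs H)" "card (pverts H) = n"
      "\<exists>M. matched_join (pverts H) (parcs H) p m M"
  shows "digraph_iso (with_proj G) (with_proj H) \<longleftrightarrow> (\<exists>M. matched_join (pverts G) (parcs G) p m M)"
proof -
  have fG: "fin_graph (pverts G) (parcs G)" by (rule pair_graph_fin_graph[OF G(1)])
  have sub: "parcs G \<subseteq> pverts G \<times> pverts G" "parcs H \<subseteq> pverts H \<times> pverts H"
    using fG H(1) by (auto dest!: fin_graph.E_sub)
  have sym: "\<exists>\<psi>. arc_iso (pverts H) (parcs H) (pverts G) (parcs G) \<psi>"
    if "arc_iso (pverts G) (parcs G) (pverts H) (parcs H) \<phi>" for \<phi>
  proof -
    have b: "bij_betw \<phi> (pverts G) (pverts H)" using that unfolding arc_iso_def by blast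
    let ?\<psi> = "inv_into (pverts G) \<phi>"
    have "?\<psi> v \<in> pverts G \<and> \<phi> (?\<psi> v) = v" if "v \<in> pverts H" for v
      using b that by (auto simp: bij_betw_def inv_into_into f_inv_into_f)
    then show ?thesis
      using that bij_betw_inv_into[OF b] unfolding arc_iso_def by (intro exI[of _ ?\<psi>]) auto
  qed
  show ?thesis
    unfolding digraph_iso_with_proj_iff[OF sub]
    using iso_of_matched_joins[OF fG H(1)] fin_graph.matched_join_iso[OF H(1)] sym G(2) H(2,3)
    by metis
qed

section \<open>Forest-free joins\<close>

context fin_graph
begin

context
  fixes I :: "'i set" and k :: "'i \<Rightarrow> nat" and p :: nat and M :: "'a set"
  assumes I: "finite I" "\<And>i. i \<in> I \<Longrightarrow> 2 \<le> k i" "(\<Sum>i\<in>I. k i div 2) = p + 1"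
    and free: "\<not> has_forest E I k V"
    and M: "dominating V E M" "card M = p"
    and large: "2 * (\<Sum>i\<in>I. k i) + p \<le> card V"
begin

text \<open>The start \<open>a b\<close> replaces the first two vertices of a path of even order, one of which would be a centre.\<close>
lemma no_inner_arc:
  assumes i: "i \<in> I" "even (k i)" and ab: "a \<in> V - M" "b \<in> V - M"
  shows "(a, b) \<notin> E"
proof
  assume E: "(a, b) \<in> E"
  have "a \<noteq> b" using E E_irrefl by metis
  obtain h where h: "k i = 2 * h" using i(2) by (elim evenE)
  have h1: "1 \<le> h" using I(2)[OF i(1)] h by simp
  have P: "set [a, b] \<inter> M = {}" using ab by auto
  have "has_forest E I k V"
  proof (rule forest_of_start[OF M(1) I(1) i(1) I(2), where P = "[a, b]" and j = "h - 1"])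
    show "card (set [a, b] \<inter> M) + (h - 1) + 1 \<le> k i div 2" unfolding P using h h1 by simp
  qed (use ab E \<open>a \<noteq> b\<close> h h1 I(3) M(2) large in simp_all)
  then show False using free by simp
qed

text \<open>The start \<open>a b c\<close> replaces the first three vertices of a path of odd order, one of which would be a
  centre.\<close>
lemma inner_arcs_matching:
  assumes i: "i \<in> I" "odd (k i)" and abc: "a \<in> V - M" "b \<in> V - M" "c \<in> V - M"
    and E: "(b, a) \<in> E" "(b, c) \<in> E"
  shows "a = c"
proof (rule ccontr)
  assume "a \<noteq> c"
  moreover have "a \<noteq> b" "b \<noteq> c" using E E_irrefl by metis+
  ultimately have dis: "distinct [a, b, c]" by simp
  have ab: "(a, b) \<in> E" using E(1) by (rule E_sym)
  obtain h where h: "k i = 2 * h + 1" using i(2) by (elim oddE)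
  have h1: "1 \<le> h" using I(2)[OF i(1)] h by simp
  have P: "set [a, b, c] \<inter> M = {}" using abc by auto
  have "has_forest E I k V"
  proof (rule forest_of_start[OF M(1) I(1) i(1) I(2), where P = "[a, b, c]" and j = "h - 1"])
    show "card (set [a, b, c] \<inter> M) + (h - 1) + 1 \<le> k i div 2" unfolding P using h h1 by simp
  qed (use abc E ab dis h h1 I(3) M(2) large in simp_all)
  then show False using free by simp
qed

text \<open>The start \<open>a b u c d\<close> with \<open>u\<close> in \<open>M\<close> uses one centre, where five alternating vertices of a path of odd
  order would use two.\<close>
lemma inner_arcs_meet:
  assumes i: "i \<in> I" "odd (k i)" "3 < k i" and p: "1 \<le> p"
    and ab: "a \<in> V - M" "b \<in> V - M" "(a, b) \<in> E" and cd: "c \<in> V - M" "d \<in> V - M" "(c, d) \<in> E"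
  shows "{a, b} \<inter> {c, d} \<noteq> {}"
proof
  assume disj: "{a, b} \<inter> {c, d} = {}"
  have "M \<noteq> {}" using M(2) p by auto
  then obtain u where u: "u \<in> M" by blast
  have uV: "u \<in> V" "u \<notin> {a, b, c, d}" using u ab cd M(1) unfolding dominating_def by auto
  have "(u, b) \<in> E" "(u, c) \<in> E" using u uV ab cd M(1) unfolding dominating_def by auto
  then have ub: "(b, u) \<in> E" "(u, c) \<in> E" using E_sym by blast+
  have "a \<noteq> b" "c \<noteq> d" using ab cd E_irrefl by metis+
  then have dis: "distinct [a, b, u, c, d]" using disj uV by auto
  have Mu: "set [a, b, u, c, d] \<inter> M = {u}" using u ab cd by auto
  obtain h where h: "k i = 2 * h + 1" using i(2) by (elim oddE)
  have h2: "2 \<le> h" using i(3) h by simp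
  have "has_forest E I k V"
  proof (rule forest_of_start[OF M(1) I(1) i(1) I(2), where P = "[a, b, u, c, d]" and j = "h - 2"])
    show "card (set [a, b, u, c, d] \<inter> M) + (h - 2) + 1 \<le> k i div 2" unfolding Mu using h h2 by simp
    show "distinct [a, b, u, c, d]" by (rule dis)
  qed (use ab cd ub uV h h2 I(3) M(2) large in simp_all)
  then show False using free by simp
qed

lemma matched_join_of_even:
  assumes "i \<in> I" "even (k i)" shows "matched_join V E p 0 M"
proof -
  have "inner_vertices V E M = {}" unfolding inner_vertices_def using no_inner_arc[OF assms] by blast
  then show ?thesis unfolding matched_join_def using M no_inner_arc[OF assms] by auto
qed

lemma matched_join_of_odd:
  assumes "i \<in> I" "odd (k i)" shows "\<exists>m\<le>2 * ((card V - p) div 2). matched_join V E p m M"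
proof -
  have mj: "matched_join V E p (card (inner_vertices V E M)) M"
    unfolding matched_join_def using M inner_arcs_matching[OF assms] by blast
  have "card (inner_vertices V E M) \<le> card (V - M)"
    using finite_V by (intro card_mono) (auto simp: inner_vertices_def)
  also have "\<dots> = card V - p"
  proof -
    have "M \<subseteq> V" using M(1) unfolding dominating_def by blast
    then show ?thesis using M(2) finite_subset[OF _ finite_V] by (simp add: card_Diff_subset)
  qed
  finally have "card (inner_vertices V E M) \<le> card V - p" .
  with matched_join_even[OF mj] have "card (inner_vertices V E M) \<le> 2 * ((card V - p) div 2)"
    by (elim evenE) simp
  then show ?thesis using mj by blast
qed

lemma matched_join_of_long_odd:
  assumes i: "i \<in> I" "odd (k i)" "3 < k i" and p: "1 \<le> p"
  shows "\<exists>m\<le>2. matched_join V E p m M"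
proof -
  have mj: "matched_join V E p (card (inner_vertices V E M)) M"
    unfolding matched_join_def using M inner_arcs_matching[OF i(1,2)] by blast
  have "card (inner_vertices V E M) \<le> 2"
  proof (cases "inner_vertices V E M = {}")
    case False
    then obtain a b where ab: "a \<in> V - M" "b \<in> V - M" "(a, b) \<in> E" unfolding inner_vertices_def by blast
    have ba: "(b, a) \<in> E" using ab(3) by (rule E_sym)
    have "c \<in> {a, b}" if "c \<in> inner_vertices V E M" for c
    proof -
      obtain d where d: "c \<in> V - M" "d \<in> V - M" "(c, d) \<in> E" using \<open>c \<in> _\<close> unfolding inner_vertices_def by blast
      have dc: "(d, c) \<in> E" using d(3) by (rule E_sym)
      consider "c = a" | "c = b" | "d = a" | "d = b" using inner_arcs_meet[OF i p ab d] by blast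
      then show ?thesis
      proof cases
        case 3
        then show ?thesis using inner_arcs_matching[OF i(1,2) ab(2,1) d(1) ab(3)] dc by simp
      next
        case 4
        then show ?thesis using inner_arcs_matching[OF i(1,2) ab(1,2) d(1) ba] dc by simp
      qed auto
    qed
    then have "card (inner_vertices V E M) \<le> card {a, b}" by (intro card_mono) auto
    also have "\<dots> \<le> 2" by (simp add: card_insert_if)
    finally show ?thesis .
  qed simp
  then show ?thesis using mj by blast
qed

end

end

section \<open>The extremal radius\<close>

lemma split_matched_join:
  assumes "M \<subseteq> V" "card M = p" shows "matched_join V (split_arcs V M) p 0 M"
proof -
  have "inner_vertices V (split_arcs V M) M = {}" by (auto simp: inner_vertices_def split_arcs_def)
  moreover have "dominating V (split_arcs V M) M"
    using assms(1) by (auto simp: dominating_def split_arcs_def)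
  ultimately show ?thesis using assms(2) by (auto simp: matched_join_def split_arcs_def)
qed

text \<open>If forest-freeness forces a graph with a dominating \<open>p\<close>-set \<open>M\<close> to be a matched join with at most \<open>m\<close>
  matched vertices, then the root \<open>b\<close> that belongs to \<open>m\<close> bounds the radius, with equality exactly for \<open>m\<close>
  matched vertices.\<close>
lemma eventually_extremal:
  fixes \<alpha> :: real and l p :: nat and k :: "nat \<Rightarrow> nat"
  assumes \<alpha>: "0 < \<alpha>" "\<alpha> < 1" and p: "1 \<le> p"
    and I: "\<forall>i\<in>{1..l}. 2 \<le> k i" "(\<Sum>i\<in>{1..l}. k i div 2) = p + 1"
  shows "eventually (\<lambda>n. \<forall>(G :: nat pair_pre_digraph) m b.
      pair_graph G \<longrightarrow> card (pverts G) = n \<longrightarrow> graph_free (linear_forest l k) G \<longrightarrow>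
      \<alpha> * real p + 1 < b \<longrightarrow> join_poly \<alpha> (real n) (real p) (real m) b = 0 \<longrightarrow>
      (\<forall>M. dominating (pverts G) (parcs G) M \<longrightarrow> card M = p \<longrightarrow>
        (\<exists>j\<le>m. matched_join (pverts G) (parcs G) p j M)) \<longrightarrow>
      rho_alpha \<alpha> G \<le> b \<and>
      (rho_alpha \<alpha> G = b \<longleftrightarrow> (\<exists>M. matched_join (pverts G) (parcs G) p m M))) sequentially"
proof -
  define e where "e = (1 - \<alpha>) / (8 * \<alpha>)"
  have e: "0 < e" unfolding e_def using \<alpha> by simp
  have p1: "1 \<le> real p" "0 < real p" using p by simp_all
  have E: "eventually (\<lambda>n. \<alpha> * real p + 1 < split_radius \<alpha> (real n) (real p) \<and>
     join_poly \<alpha> (real n) (real p) 0 (split_radius \<alpha> (real n) (real p)) = 0 \<and>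
     \<alpha> * real n - 1 + real p * (1 - \<alpha>) / \<alpha> - e < split_radius \<alpha> (real n) (real p)) sequentially"
    by (rule eventually_split_radius_gt[OF \<alpha> p1(1) e])
  note D = eventually_dominating[where 'a = nat, OF \<alpha> finite_atLeastAtMost[of 1 l] I, folded e_def]
  have "eventually (\<lambda>n. p \<le> n) sequentially" by (rule eventually_ge_at_top)
  with E D show ?thesis
  proof eventually_elim
    case (elim n)
    define s where "s = split_radius \<alpha> (real n) (real p)"
    have s: "\<alpha> * real p + 1 < s" "join_poly \<alpha> (real n) (real p) 0 s = 0"
      "\<alpha> * real n - 1 + real p * (1 - \<alpha>) / \<alpha> - e < s" using elim(1) unfolding s_def by auto
    have pn: "real p \<le> real n" "0 < n" using elim(3) p by simp_all
    note D = elim(2)[rule_format]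
    show ?case
    proof (intro allI impI)
      fix G :: "nat pair_pre_digraph" and m b
      assume G: "pair_graph G" and c: "card (pverts G) = n" and free: "graph_free (linear_forest l k) G"
        and b: "\<alpha> * real p + 1 < b" "join_poly \<alpha> (real n) (real p) (real m) b = 0"
        and struct: "\<forall>M. dominating (pverts G) (parcs G) M \<longrightarrow> card M = p \<longrightarrow>
          (\<exists>j\<le>m. matched_join (pverts G) (parcs G) p j M)"
      let ?V = "pverts G" and ?E = "parcs G" and ?r = "rho_alpha \<alpha> G"
      interpret fin_graph ?V ?E by (rule pair_graph_fin_graph[OF G])
      have ne: "?V \<noteq> {}" using c pn(2) by auto
      have r: "is_alpha_radius \<alpha> ?V ?E ?r" using G ne \<alpha> by (intro rho_alpha_is_radius) auto
      have sb: "s \<le> b"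
        using join_poly_root_mono[OF \<alpha> p1(1) pn(1) s(1,2) b order_refl] by simp
      have eq: "?r = b" if "matched_join ?V ?E p m M" for M
        using radius_of_matched_join[OF \<alpha> p that _ _ r] b c by blast
      have ex: "\<exists>M. matched_join ?V ?E p m M" if le: "b \<le> ?r"
      proof -
        have nf: "\<not> has_forest ?E {1..l} k ?V" using not_graph_free[OF G] free by blast
        have split: "\<exists>t\<le>?r. is_alpha_radius \<alpha> ?V (split_arcs ?V M) t" if M: "M \<subseteq> ?V" "card M = p" for M
        proof -
          interpret S: fin_graph ?V "split_arcs ?V M" by (rule fin_graph_split[OF finite_V])
          obtain t where t: "is_alpha_radius \<alpha> ?V (split_arcs ?V M) t"
            using S.radius_exists[OF ne] \<alpha> by (metis less_imp_le)
          have "t = s"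
            using S.radius_of_matched_join[OF \<alpha> p split_matched_join[OF M] _ _ t] s(1,2) c by simp
          then have "t \<le> ?r" using sb le by simp
          then show ?thesis using t by blast
        qed
        have "\<exists>M. card M = p \<and> dominating ?V ?E M"
          using D[OF fin_graph_axioms c nf r] split s(3) sb le by fastforce
        then obtain M j where M: "j \<le> m" "matched_join ?V ?E p j M" using struct by blast
        obtain t where t: "\<alpha> * real p + 1 < t" "join_poly \<alpha> (real n) (real p) (real j) t = 0"
          using join_poly_root_exists[OF \<alpha>(2) p1(2) _ s(1,2), of "real j"] by auto
        have rt: "?r = t" using radius_of_matched_join[OF \<alpha> p M(2) _ _ r] t c by blast
        have "t \<le> b" using join_poly_root_mono[OF \<alpha> p1(1) pn(1) t b] M(1) by simp
        then have "t = b" using rt le by simp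
        then have "real j = real m" using join_poly_root_inj[OF \<alpha>(2) p1(2) t(2)] b(2) by simp
        then show ?thesis using M(2) by auto
      qed
      show "?r \<le> b \<and> (?r = b \<longleftrightarrow> (\<exists>M. matched_join ?V ?E p m M))"
        using eq ex by (metis linear order_refl)
    qed
  qed
qed

theorem theorem1p1:
  fixes l p :: nat and k :: "nat \<Rightarrow> nat" and \<alpha> :: real
  assumes "1 \<le> l"
    and "\<forall>i\<in>{1..l}. \<forall>j\<in>{1..l}. i \<le> j \<longrightarrow> k j \<le> k i"
    and "\<forall>i\<in>{1..l}. 2 \<le> k i"
    and "p = (\<Sum>i = 1..l. k i div 2) - 1"
    and "1 \<le> p"
    and "0 < \<alpha>" and "\<alpha> < 1"
  shows "\<exists>n0::nat. \<forall>n\<ge>n0. \<forall>G :: nat pair_pre_digraph.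
    pair_graph G \<and> card (pverts G) = n \<and> graph_free (linear_forest l k) G \<longrightarrow>
      ((\<exists>i\<in>{1..l}. even (k i)) \<longrightarrow>
        (let b = (\<alpha> * real n + real p - 1
                  + sqrt ((\<alpha> * real n + real p - 1) ^ 2 - 4 * real p * (2 * \<alpha> - 1) * real n
                          - 4 * real p * (real p - (real p + 1) * \<alpha>))) / 2
         in rho_alpha \<alpha> G \<le> b \<and>
            (rho_alpha \<alpha> G = b \<longleftrightarrow> digraph_iso (with_proj G) (with_proj (S_graph n p))))) \<and>
      ((\<forall>i\<in>{1..l}. odd (k i)) \<and> (\<exists>i\<in>{1..l}. k i > 3) \<longrightarrow>
        (let b = largest_root (f_cubic \<alpha> (real n) (real p))
         in rho_alpha \<alpha> G \<le> b \<and>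
            (rho_alpha \<alpha> G = b \<longleftrightarrow> digraph_iso (with_proj G) (with_proj (S_plus_graph n p))))) \<and>
      ((\<forall>i\<in>{1..l}. k i = 3) \<longrightarrow>
         rho_alpha \<alpha> G \<le> t_alpha \<alpha> n p \<and>
         (rho_alpha \<alpha> G = t_alpha \<alpha> n p \<longleftrightarrow> digraph_iso (with_proj G) (with_proj (F_graph n p))))"
proof -
  note \<alpha> = \<open>0 < \<alpha>\<close> \<open>\<alpha> < 1\<close> and p = \<open>1 \<le> p\<close>
  let ?I = "{1..l}"
  define N where "N = (\<Sum>i\<in>?I. k i)"
  have k2: "\<And>i. i \<in> ?I \<Longrightarrow> 2 \<le> k i" using assms(3) by blast
  have sum: "(\<Sum>i\<in>?I. k i div 2) = p + 1" using assms(4,5) by simp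
  have p1: "1 \<le> real p" "0 < real p" using p by simp_all
  have "eventually (\<lambda>n. \<alpha> * real p + 1 < split_radius \<alpha> (real n) (real p) \<and>
     join_poly \<alpha> (real n) (real p) 0 (split_radius \<alpha> (real n) (real p)) = 0 \<and>
     \<alpha> * real n - 1 + real p * (1 - \<alpha>) / \<alpha> - 1 < split_radius \<alpha> (real n) (real p)) sequentially"
    by (rule eventually_split_radius_gt[OF \<alpha> p1(1)]) simp
  moreover note eventually_extremal[OF \<alpha> p assms(3) sum]
  moreover have "eventually (\<lambda>n. 2 * N + p + 2 \<le> n) sequentially" by (rule eventually_ge_at_top)
  ultimately have "eventually (\<lambda>n. \<forall>G :: nat pair_pre_digraph.
    pair_graph G \<and> card (pverts G) = n \<and> graph_free (linear_forest l k) G \<longrightarrow>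
      ((\<exists>i\<in>{1..l}. even (k i)) \<longrightarrow>
         rho_alpha \<alpha> G \<le> split_radius \<alpha> (real n) (real p) \<and>
         (rho_alpha \<alpha> G = split_radius \<alpha> (real n) (real p) \<longleftrightarrow>
           digraph_iso (with_proj G) (with_proj (S_graph n p)))) \<and>
      ((\<forall>i\<in>{1..l}. odd (k i)) \<and> (\<exists>i\<in>{1..l}. k i > 3) \<longrightarrow>
         rho_alpha \<alpha> G \<le> largest_root (f_cubic \<alpha> (real n) (real p)) \<and>
         (rho_alpha \<alpha> G = largest_root (f_cubic \<alpha> (real n) (real p)) \<longleftrightarrow>
           digraph_iso (with_proj G) (with_proj (S_plus_graph n p)))) \<and>
      ((\<forall>i\<in>{1..l}. k i = 3) \<longrightarrow>
         rho_alpha \<alpha> G \<le> t_alpha \<alpha> n p \<and>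
         (rho_alpha \<alpha> G = t_alpha \<alpha> n p \<longleftrightarrow> digraph_iso (with_proj G) (with_proj (F_graph n p)))))
      sequentially"
  proof eventually_elim
    case (elim n)
    define s where "s = split_radius \<alpha> (real n) (real p)"
    have s: "\<alpha> * real p + 1 < s" "join_poly \<alpha> (real n) (real p) 0 s = 0" using elim(1) unfolding s_def by auto
    have n: "2 * N + p \<le> n" "p + 2 \<le> n" "p + 1 \<le> n" "p \<le> n" "real p \<le> real n" using elim(3) by simp_all
    have root: "\<exists>b. \<alpha> * real p + 1 < b \<and> join_poly \<alpha> (real n) (real p) (real m) b = 0" for m :: nat
      using join_poly_root_exists[OF \<alpha>(2) p1(2) _ s, of "real m"] by auto
    note ext = elim(2)[rule_format]
    show ?case
    proof (intro allI impI, elim conjE)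
      fix G :: "nat pair_pre_digraph"
      assume G: "pair_graph G" and c: "card (pverts G) = n" and free: "graph_free (linear_forest l k) G"
      let ?V = "pverts G" and ?E = "parcs G" and ?r = "rho_alpha \<alpha> G"
      interpret fin_graph ?V ?E by (rule pair_graph_fin_graph[OF G])
      have nf: "\<not> has_forest ?E ?I k ?V" using not_graph_free[OF G] free by blast
      have large: "2 * (\<Sum>i\<in>?I. k i) + p \<le> card ?V" using n(1) c unfolding N_def by simp
      have even_case: "?r \<le> s \<and> (?r = s \<longleftrightarrow> digraph_iso (with_proj G) (with_proj (S_graph n p)))"
        if i: "i \<in> ?I" "even (k i)" for i
      proof -
        have "\<exists>j\<le>0. matched_join ?V ?E p j M" if "dominating ?V ?E M" "card M = p" for M
          using matched_join_of_even[OF finite_atLeastAtMost k2 sum nf that large i] by blast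
        then have "?r \<le> s \<and> (?r = s \<longleftrightarrow> (\<exists>M. matched_join ?V ?E p 0 M))"
          using s by (intro ext G c free) simp_all
        then show ?thesis
          using digraph_iso_iff_matched_join[OF G c S_graph_matched[OF n(4)]] by simp
      qed
      have odd_case: "?r \<le> largest_root (f_cubic \<alpha> (real n) (real p)) \<and>
          (?r = largest_root (f_cubic \<alpha> (real n) (real p)) \<longleftrightarrow>
            digraph_iso (with_proj G) (with_proj (S_plus_graph n p)))"
        if i: "i \<in> ?I" "odd (k i)" "3 < k i" for i
      proof -
        obtain b where b: "\<alpha> * real p + 1 < b" "join_poly \<alpha> (real n) (real p) (real 2) b = 0"
          using root by blast
        have lr: "largest_root (f_cubic \<alpha> (real n) (real p)) = b"
          using b f_cubic_eq by (intro largest_root_join_poly[OF \<alpha> p1(1) n(5), of 2]) simp_all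
        have "\<exists>j\<le>2. matched_join ?V ?E p j M" if "dominating ?V ?E M" "card M = p" for M
          by (rule matched_join_of_long_odd[OF finite_atLeastAtMost k2 sum nf that large i p])
        then have "?r \<le> b \<and> (?r = b \<longleftrightarrow> (\<exists>M. matched_join ?V ?E p 2 M))"
          using b by (intro ext G c free) simp_all
        then show ?thesis
          unfolding lr using digraph_iso_iff_matched_join[OF G c S_plus_graph_matched[OF n(2)]] by simp
      qed
      have three_case: "?r \<le> t_alpha \<alpha> n p \<and>
          (?r = t_alpha \<alpha> n p \<longleftrightarrow> digraph_iso (with_proj G) (with_proj (F_graph n p)))"
        if i: "i \<in> ?I" "odd (k i)" for i
      proof -
        let ?m = "2 * ((n - p) div 2)"
        obtain b where b: "\<alpha> * real p + 1 < b" "join_poly \<alpha> (real n) (real p) (real ?m) b = 0"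
          using root by blast
        have ta: "t_alpha \<alpha> n p = b" using \<alpha> p n(3) b by (rule t_alpha_eq)
        have "\<exists>j\<le>?m. matched_join ?V ?E p j M" if "dominating ?V ?E M" "card M = p" for M
          using matched_join_of_odd[OF finite_atLeastAtMost k2 sum nf that large i] c by simp
        then have "?r \<le> b \<and> (?r = b \<longleftrightarrow> (\<exists>M. matched_join ?V ?E p ?m M))"
          using b by (intro ext G c free) simp_all
        then show ?thesis
          unfolding ta using digraph_iso_iff_matched_join[OF G c F_graph_matched[OF n(4)]] by simp
      qed
      have "1 \<in> ?I" using assms(1) by simp
      then have three: "\<exists>i\<in>?I. odd (k i)" if "\<forall>i\<in>?I. k i = 3" using that by (intro bexI[of _ 1]) simp_all
      show "((\<exists>i\<in>?I. even (k i)) \<longrightarrow>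
         ?r \<le> split_radius \<alpha> (real n) (real p) \<and>
         (?r = split_radius \<alpha> (real n) (real p) \<longleftrightarrow>
           digraph_iso (with_proj G) (with_proj (S_graph n p)))) \<and>
        ((\<forall>i\<in>?I. odd (k i)) \<and> (\<exists>i\<in>?I. k i > 3) \<longrightarrow>
         ?r \<le> largest_root (f_cubic \<alpha> (real n) (real p)) \<and>
         (?r = largest_root (f_cubic \<alpha> (real n) (real p)) \<longleftrightarrow>
           digraph_iso (with_proj G) (with_proj (S_plus_graph n p)))) \<and>
        ((\<forall>i\<in>?I. k i = 3) \<longrightarrow>
         ?r \<le> t_alpha \<alpha> n p \<and>
         (?r = t_alpha \<alpha> n p \<longleftrightarrow> digraph_iso (with_proj G) (with_proj (F_graph n p))))"
        using even_case odd_case three_case three unfolding s_def by blast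
    qed
  qed
  then show ?thesis
    unfolding eventually_sequentially split_radius_def Let_def .
qed

end
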